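(* Let $\sigma^2_{n^*}\triangleq\min_{i\in\{1,\ldots,M\}}\sigma^2_{n_i}$ and assume $\sigma^2_{n^*}\ge (2\pi e)^{-1}$. Let $N$ be the sampling budget (an integer with $1\le N\le |V|$) and let $X^*\in\arg\max_{X\subseteq V:\,|X|=N}F(X)$. Given $\epsilon_1\ge 0$, suppose that $$\Sigma^{\mathrm{PITC}}_{\langle x,i\rangle\langle x,i\rangle\mid \widetilde X\cup (V_t\setminus X_t)}-\Sigma^{\mathrm{PITC}}_{\langle x,i\rangle\langle x,i\rangle\mid X\cup (V_t\setminus X_t)}\le\epsilon_1$$ for all $\widetilde X\subseteq X\subseteq V$ and all $\langle x,i\rangle\in V_{-t}\setminus X_{-t}$. Let $X$ be the output of the greedy algorithm that starts from $X=\emptyset$ and, $N$ times, replaces $X$ by $X\cup\{\langle x,i\rangle^+\}$ where $\langle x,i\rangle^+\in\arg\max_{\langle x,i\rangle\in V\setminus X}\big(F(X\cup\{\langle x,i\rangle\})-F(X)\big)$. Then $$F(X)\ \ge\ (1-1/e)\,\big(F(X^* )-N\epsilon\big),\qquad \epsilon=\tfrac12\log\!\left(1+\epsilon_1/\sigma^2_{n^*}\right).$$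
   Context: Setting. There are $M$ measurement types and a set $D$ of locations (vectors in $\mathbb{R}^d$); $D_i^+=\{\langle x,i\rangle: x\in D\}$, $D^+=\bigcup_{i=1}^M D_i^+$. $Y_{\langle x,i\rangle}$ is the (random) noisy measurement of type $i$ at $x$, and $Y_A=(Y_{\langle x,i\rangle})_{\langle x,i\rangle\in A}$. $V_i\subset D_i^+$ are finite sets of candidates, $V=\bigcup_i V_i$; $t\in\{1,\ldots,M\}$ is a fixed target type. For $A\subseteq D^+$ write $A_i=A\cap D_i^+$ and $A_{-t}=\bigcup_{i\ne t}A_i$. $U\subset D$ is a finite set of inducing locations and $L_U=(L(x))_{x\in U}$ the vector of values of a latent Gaussian process $L$ at $U$. $P_0,P_1,\ldots,P_M$ are diagonal precision matrices, $\sigma^2_{s_i}$ are signal variances and $\sigma^2_{n_i}>0$ noise variances. $\mathcal N(z\mid\underline 0,C)$ is the Gaussian density with mean zero and covariance $C$ evaluated at $z$. Covariances (convolved multi-output Gaussian process): $\sigma_{xx'}=\mathcal N(x-x'\mid\underline0,P_0^{-1})$ for $x,x'\in U$; $\sigma_{\langle x,i\rangle x'}=\sigma_{s_i}\mathcal N(x-x'\mid\underline0,P_0^{-1}+P_i^{-1})$ for $\langle x,i\rangle\in D^+$, $x'\in U$; $\sigma_{\langle x,i\rangle\langle x',j\rangle}=\sigma_{s_i}\sigma_{s_j}\mathcal N(x-x'\mid\underline0,P_0^{-1}+P_i^{-1}+P_j^{-1})+\delta\,\sigma^2_{n_i}$, with $\delta=1$ if $i=j$ and $x=x'$, else $0$.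 $\Sigma_{AA'},\Sigma_{AU},\Sigma_{UU}$ are the corresponding matrices, $\Sigma_{UA}=\Sigma_{AU}^\top$. $\Gamma_{AA'}=\Sigma_{AU}\Sigma_{UU}^{-1}\Sigma_{UA'}$, $\Sigma_{AA|U}=\Sigma_{AA}-\Gamma_{AA}$, and $\Lambda_A$ is the block-diagonal matrix with diagonal blocks $\Sigma_{A_iA_i|U}$, $i=1,\ldots,M$. Sparse (PITC: partially independent training conditional) model. Structural properties: (P1) measurements of different types are conditionally independent given $L_U$; (P2) for a set $X$ of observed tuples and a set $Z\subseteq D^+\setminus X$ of unobserved tuples, $Y_X$ and $Y_Z$ are conditionally independent given $L_U$. The posterior covariance of $Y_Z$ given $Y_X$ is $$\Sigma^{\mathrm{PITC}}_{ZZ|X}=\Gamma_{ZZ}+\Lambda_Z-\Gamma_{ZX}(\Gamma_{XX}+\Lambda_X)^{-1}\Gamma_{XZ}.$$ Entropies are Gaussian (natural logarithm): $H(Y_Z|Y_X)=\tfrac12\log\big((2\pi e)^{|Z|}|\Sigma^{\mathrm{PITC}}_{ZZ|X}|\big)$, $H(Y_A|L_U)=\tfrac12\log\big((2\pi e)^{|A|}|\Sigma_{AA|U}|\big)$, $H(L_U|Y_A)=\tfrac12\log\big((2\pi e)^{|U|}|\Sigma_{UU|A}|\big)$ with $\Sigma_{UU|A}=\Sigma_{UU}(\Sigma_{UU}+\Sigma_{UA}\Lambda_A^{-1}\Sigma_{AU})^{-1}\Sigma_{UU}$; the entropy of an empty vector is $0$, and conditioning on an empty vector is no conditioning. Criterion: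 for $X\subseteq V$, $$F(X)=H(Y_{X_t}|L_U)-I(L_U;Y_{V_t\setminus X_t}|Y_X)+I(L_U;Y_{V_t}),$$ where $I(L_U;Y_{V_t\setminus X_t}|Y_X)=H(L_U|Y_X)-H(L_U|Y_{X\cup(V_t\setminus X_t)})$ and $I(L_U;Y_{V_t})=H(L_U)-H(L_U|Y_{V_t})$. *)

theory Defs
  imports Complex_Main
    "Jordan_Normal_Form.Determinant"
    "Jordan_Normal_Form.Gauss_Jordan_Elimination"
begin

definition minv :: "real mat \<Rightarrow> real mat" where
  "minv A = the (mat_inverse A)"

(* Density of the centred Gaussian with covariance C at z, C being an n x n matrix. *)
definition gauss_density :: "real vec \<Rightarrow> real mat \<Rightarrow> real" where
  "gauss_density z C =
     exp (- (z \<bullet> (minv C *\<^sub>v z)) / 2) / sqrt ((2 * pi) ^ dim_row C * det C)"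

(* Matrices indexed by finite sets are matrices over a fixed but arbitrary enumeration
   of the index set.  The same enumeration is used everywhere a set occurs, so products
   match up, and determinants do not depend on it. *)
definition enum_set :: "'a set \<Rightarrow> 'a list" where
  "enum_set A = (SOME xs. distinct xs \<and> set xs = A)"

definition set_mat :: "('a \<Rightarrow> 'b \<Rightarrow> real) \<Rightarrow> 'a set \<Rightarrow> 'b set \<Rightarrow> real mat" where
  "set_mat k A B =
     mat (card A) (card B) (\<lambda>(r, c). k (enum_set A ! r) (enum_set B ! c))"

(* Differential entropy of a Gaussian vector with covariance C; it is 0 for the 0 x 0 matrix. *)
definition gauss_entropy :: "real mat \<Rightarrow> real" where
  "gauss_entropy C = 1 / 2 * ln ((2 * pi * exp 1) ^ dim_row C * det C)"

(* A pair (x, i) stands for the measurement of type i at location x. *)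
type_synonym tuple = "real vec \<times> nat"

definition tuples :: "nat \<Rightarrow> real vec set \<Rightarrow> tuple set" where
  "tuples M D = (\<Union>i\<in>{1..M}. D \<times> {i})"

definition of_type :: "real vec set \<Rightarrow> nat \<Rightarrow> tuple set \<Rightarrow> tuple set" where
  "of_type D i A = A \<inter> (D \<times> {i})"

definition not_of_type :: "nat \<Rightarrow> real vec set \<Rightarrow> nat \<Rightarrow> tuple set \<Rightarrow> tuple set" where
  "not_of_type M D t A = (\<Union>i\<in>{1..M} - {t}. of_type D i A)"

(* P: precision matrices (P 0 belongs to the latent process); sv: signal variances;
   nv: noise variances; U: inducing locations. *)
context
  fixes P :: "nat \<Rightarrow> real mat" and sv nv :: "nat \<Rightarrow> real" and U :: "real vec set"
begin

definition cov_LL :: "real vec \<Rightarrow> real vec \<Rightarrow> real" where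
  "cov_LL x x' = gauss_density (x - x') (minv (P 0))"

definition cov_YL :: "tuple \<Rightarrow> real vec \<Rightarrow> real" where
  "cov_YL = (\<lambda>(x, i) x'. sqrt (sv i) * gauss_density (x - x') (minv (P 0) + minv (P i)))"

definition cov_YY :: "tuple \<Rightarrow> tuple \<Rightarrow> real" where
  "cov_YY = (\<lambda>(x, i) (x', j).
     sqrt (sv i) * sqrt (sv j)
       * gauss_density (x - x') (minv (P 0) + minv (P i) + minv (P j))
     + (if i = j \<and> x = x' then nv i else 0))"

definition Sigma_UU :: "real mat" where
  "Sigma_UU = set_mat cov_LL U U"

definition Sigma_AU :: "tuple set \<Rightarrow> real mat" where
  "Sigma_AU A = set_mat cov_YL A U"

definition Sigma_AA :: "tuple set \<Rightarrow> tuple set \<Rightarrow> real mat" where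
  "Sigma_AA A A' = set_mat cov_YY A A'"

definition Gam :: "tuple set \<Rightarrow> tuple set \<Rightarrow> real mat" where
  "Gam A A' = Sigma_AU A * minv Sigma_UU * transpose_mat (Sigma_AU A')"

definition Sigma_given_U :: "tuple set \<Rightarrow> real mat" where
  "Sigma_given_U A = Sigma_AA A A - Gam A A"

(* Entries of Sigma_given_U A between tuples of different types are set to 0; up to a
   reordering of A by type this is the block-diagonal matrix whose blocks are
   Sigma_given_U applied to the parts of A of each single type. *)
definition Lam :: "tuple set \<Rightarrow> real mat" where
  "Lam A = mat (card A) (card A) (\<lambda>(r, c).
     if snd (enum_set A ! r) = snd (enum_set A ! c) then Sigma_given_U A $$ (r, c) else 0)"

definition Sigma_PITC :: "tuple set \<Rightarrow> tuple set \<Rightarrow> real mat" where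
  "Sigma_PITC Z X = Gam Z Z + Lam Z - Gam Z X * minv (Gam X X + Lam X) * Gam X Z"

definition var_PITC :: "tuple \<Rightarrow> tuple set \<Rightarrow> real" where
  "var_PITC y X = Sigma_PITC {y} X $$ (0, 0)"

definition Sigma_UU_given :: "tuple set \<Rightarrow> real mat" where
  "Sigma_UU_given A =
     Sigma_UU
     * minv (Sigma_UU + transpose_mat (Sigma_AU A) * minv (Lam A) * Sigma_AU A)
     * Sigma_UU"

definition H_Y_given_L :: "tuple set \<Rightarrow> real" where
  "H_Y_given_L A = gauss_entropy (Sigma_given_U A)"

definition H_L :: real where
  "H_L = gauss_entropy Sigma_UU"

definition H_L_given :: "tuple set \<Rightarrow> real" where
  "H_L_given A = gauss_entropy (Sigma_UU_given A)"

definition I_L :: "tuple set \<Rightarrow> real" where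
  "I_L A = H_L - H_L_given A"

definition I_L_given :: "tuple set \<Rightarrow> tuple set \<Rightarrow> real" where
  "I_L_given B A = H_L_given A - H_L_given (A \<union> B)"

definition criterion :: "real vec set \<Rightarrow> tuple set \<Rightarrow> nat \<Rightarrow> tuple set \<Rightarrow> real" where
  "criterion D V t X =
     H_Y_given_L (of_type D t X)
     - I_L_given (of_type D t V - of_type D t X) X
     + I_L (of_type D t V)"

end

(* greedy F V n X: X is a possible result of n greedy steps, ties being broken arbitrarily. *)
inductive greedy :: "('a set \<Rightarrow> real) \<Rightarrow> 'a set \<Rightarrow> nat \<Rightarrow> 'a set \<Rightarrow> bool"
  for F :: "'a set \<Rightarrow> real" and V :: "'a set" where
  greedy_0: "greedy F V 0 {}"
| greedy_Suc: "greedy F V n X \<Longrightarrow>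
     is_arg_max (\<lambda>y. F (X \<union> {y}) - F X) (\<lambda>y. y \<in> V - X) y \<Longrightarrow>
     greedy F V (Suc n) (X \<union> {y})"

end

theory Submission
  imports "HOL-Probability.Distributions" Defs
begin

text \<open>
  Write \<open>K = \<Gamma> + \<Lambda>\<close>. By Sylvester's determinant identity and the block structure of \<open>\<Lambda>\<close>,
  up to a constant \<open>2 F(X)\<close> is \<open>|X\<^sub>t| log (2\<pi>e) + log |K\<^sub>X| - log |K\<^sub>W|\<close> with \<open>W = X \<union> V\<^sub>t\<close>.
  Hence \<open>F\<close> is monotone, and its gain at a tuple of type \<open>t\<close> is half the logarithm of \<open>2\<pi>e\<close> times
  a conditional variance under \<open>K\<close>, which decreases with \<open>X\<close>. So the greedy set is within a
  factor \<open>1 - 1/e\<close> of every set \<open>S \<subseteq> V\<^sub>t\<close> of at most \<open>N\<close> tuples.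

  The hypothesis does not directly give approximate submodularity at the other types, as the given
  \<open>\<Sigma>\<close>-PITC ignores the \<open>\<Lambda>\<close>-correlation between observed and unobserved tuples of the same type, while
  \<open>F\<close> does not. Instead, split \<open>X\<^sup>* = S \<union> Y\<close> with \<open>S\<close> of type \<open>t\<close>. Then \<open>F(X\<^sup>*) - F(S)\<close> is the information that
  \<open>Y\<close> carries on \<open>V\<^sub>t - S\<close> given \<open>S\<close>. Lowering the conditional covariance of \<open>Y\<close> given \<open>V\<^sub>t\<close> to the
  noise level only increases it, and after that each element of \<open>Y\<close> contributes at most \<open>\<epsilon>\<close>, by the
  hypothesis for the sets \<open>S \<subseteq> V\<^sub>t\<close>. So \<open>F(X\<^sup>*) \<le> F(S) + N\<epsilon>\<close>.
\<close>

unbundle no vec_syntax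
unbundle no inner_syntax

section \<open>Matrices indexed by finite sets\<close>

lemma enum_set_properties:
  assumes "finite A"
  shows "distinct (enum_set A)" "set (enum_set A) = A" "length (enum_set A) = card A"
proof -
  have "\<exists>xs. distinct xs \<and> set xs = A"
    using finite_distinct_list[OF assms] by blast
  then have *: "distinct (enum_set A) \<and> set (enum_set A) = A"
    unfolding enum_set_def by (rule someI_ex)
  then show "distinct (enum_set A)" "set (enum_set A) = A" by auto
  then show "length (enum_set A) = card A"
    using distinct_card by metis
qed

lemma enum_set_nth_mem:
  assumes "finite A" "i < card A"
  shows "enum_set A ! i \<in> A"
  using enum_set_properties[OF assms(1)] assms(2) nth_mem by metis

lemma enum_set_nth_eq_iff:
  assumes "finite A" "i < card A" "j < card A"
  shows "enum_set A ! i = enum_set A ! j \<longleftrightarrow> i = j"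
  using enum_set_properties[OF assms(1)] assms(2,3) nth_eq_iff_index_eq by metis

lemma enum_set_index:
  assumes "finite A" "a \<in> A"
  obtains i where "i < card A" "enum_set A ! i = a"
  using enum_set_properties[OF assms(1)] assms(2) in_set_conv_nth by metis

lemma inj_on_enum_set: "finite A \<Longrightarrow> inj_on ((!) (enum_set A)) {..<card A}"
  using enum_set_nth_eq_iff by (auto simp: inj_on_def)

lemma sum_enum_set:
  assumes "finite A"
  shows "(\<Sum>i<card A. f (enum_set A ! i)) = sum f A"
proof (rule sum.reindex_bij_betw)
  show "bij_betw ((!) (enum_set A)) {..<card A} A"
    using bij_betw_nth[of "enum_set A" "{..<card A}" A] enum_set_properties[OF assms] by simp
qed

lemma set_mat_carrier [simp]: "set_mat k A B \<in> carrier_mat (card A) (card B)"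
  by (simp add: set_mat_def)

lemma set_mat_dim [simp]:
  "dim_row (set_mat k A B) = card A" "dim_col (set_mat k A B) = card B"
  by (simp_all add: set_mat_def)

lemma set_mat_index:
  assumes "i < card A" "j < card B"
  shows "set_mat k A B $$ (i, j) = k (enum_set A ! i) (enum_set B ! j)"
  using assms by (simp add: set_mat_def)

lemma set_mat_cong:
  assumes "finite A" "finite B" "\<And>a b. a \<in> A \<Longrightarrow> b \<in> B \<Longrightarrow> k a b = l a b"
  shows "set_mat k A B = set_mat l A B"
  using assms by (intro eq_matI) (auto simp: set_mat_index enum_set_nth_mem)

text \<open>As the enumerations reach every index, a matrix determines its kernel on the index sets.
  This turns matrix equations into pointwise ones.\<close>

lemma set_mat_eqD:
  assumes "set_mat k A B = set_mat l A B" "finite A" "finite B" "a \<in> A" "b \<in> B"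
  shows "k a b = l a b"
proof -
  obtain i where i: "i < card A" "enum_set A ! i = a"
    using enum_set_index assms(2,4) by metis
  obtain j where j: "j < card B" "enum_set B ! j = b"
    using enum_set_index assms(3,5) by metis
  show ?thesis
    using set_mat_index[OF i(1) j(1), of k] set_mat_index[OF i(1) j(1), of l] i j assms(1) by simp
qed

text \<open>The kernel is read off through the inverse of the enumeration, so every matrix of the
  right size, an inverse in particular, can be handled as a kernel.\<close>

lemma ex_set_mat:
  assumes "finite A" "finite B" "M \<in> carrier_mat (card A) (card B)"
  obtains k where "M = set_mat k A B"
proof
  let ?i = "\<lambda>A. the_inv_into {..<card A} ((!) (enum_set A))"
  show "M = set_mat (\<lambda>a b. M $$ (?i A a, ?i B b)) A B"
    using assms the_inv_into_f_f[OF inj_on_enum_set[OF assms(1)]]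
      the_inv_into_f_f[OF inj_on_enum_set[OF assms(2)]]
    by (intro eq_matI) (auto simp: set_mat_index)
qed

lemma set_mat_add: "set_mat k A B + set_mat l A B = set_mat (\<lambda>a b. k a b + l a b) A B"
  by (intro eq_matI) (auto simp: set_mat_index)

lemma set_mat_minus: "set_mat k A B - set_mat l A B = set_mat (\<lambda>a b. k a b - l a b) A B"
  by (intro eq_matI) (auto simp: set_mat_index)

lemma set_mat_transpose: "transpose_mat (set_mat k A B) = set_mat (\<lambda>b a. k a b) B A"
  by (intro eq_matI) (auto simp: set_mat_index)

lemma set_mat_mult:
  assumes "finite B"
  shows "set_mat k A B * set_mat l B C = set_mat (\<lambda>a c. \<Sum>b\<in>B. k a b * l b c) A C"
proof (intro eq_matI, goal_cases)
  case (1 i j)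
  have "(set_mat k A B * set_mat l B C) $$ (i, j)
    = (\<Sum>r<card B. k (enum_set A ! i) (enum_set B ! r) * l (enum_set B ! r) (enum_set C ! j))"
    using 1 by (simp add: scalar_prod_def set_mat_index lessThan_atLeast0)
  also have "\<dots> = (\<Sum>b\<in>B. k (enum_set A ! i) b * l b (enum_set C ! j))"
    using sum_enum_set[OF assms, of "\<lambda>b. k (enum_set A ! i) b * l b (enum_set C ! j)"] .
  finally show ?case using 1 by (simp add: set_mat_index)
qed auto

lemma one_mat_eq_set_mat:
  assumes "finite A"
  shows "1\<^sub>m (card A) = set_mat (\<lambda>a b. of_bool (a = b)) A A"
  using enum_set_nth_eq_iff[OF assms] by (intro eq_matI) (auto simp: set_mat_index)

section \<open>Inverse matrices and their kernels\<close>

lemma minv_inverse: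
  assumes "A \<in> carrier_mat n n" "det A \<noteq> 0"
  shows "minv A \<in> carrier_mat n n" "A * minv A = 1\<^sub>m n" "minv A * A = 1\<^sub>m n"
proof -
  obtain B where "mat_inverse A = Some B"
    using mat_inverse(1)[OF assms(1)] det_non_zero_imp_unit[OF assms] by fastforce
  with mat_inverse(2)[OF assms(1) this]
  show "minv A \<in> carrier_mat n n" "A * minv A = 1\<^sub>m n" "minv A * A = 1\<^sub>m n"
    by (simp_all add: minv_def)
qed

lemma det_minv:
  assumes "A \<in> carrier_mat n n" "det A \<noteq> 0"
  shows "det (minv A) = 1 / det A"
proof -
  have "det A * det (minv A) = 1"
    using det_mult[OF assms(1) minv_inverse(1)[OF assms]] minv_inverse(2)[OF assms] by simp
  then show ?thesis using assms(2) by (simp add: field_simps)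
qed

lemma minv_eqI:
  assumes A: "A \<in> carrier_mat n n" and B: "B \<in> carrier_mat n n" and AB: "A * B = 1\<^sub>m n"
  shows "minv A = B"
proof -
  have "det A * det B = 1" using det_mult[OF A B] AB by simp
  then have det: "det A \<noteq> 0" by auto
  note inv = minv_inverse[OF A det]
  have "minv A = minv A * (A * B)" using AB inv(1) by simp
  also have "\<dots> = (minv A * A) * B" using A B inv(1) by (simp add: assoc_mult_mat)
  also have "\<dots> = B" using inv(3) B by simp
  finally show ?thesis .
qed

lemma minv_set_mat:
  assumes "finite A" "det (set_mat k A A) \<noteq> 0"
  obtains w where "minv (set_mat k A A) = set_mat w A A"
    "\<And>a c. a \<in> A \<Longrightarrow> c \<in> A \<Longrightarrow> (\<Sum>b\<in>A. k a b * w b c) = of_bool (a = c)"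
    "\<And>a c. a \<in> A \<Longrightarrow> c \<in> A \<Longrightarrow> (\<Sum>b\<in>A. w a b * k b c) = of_bool (a = c)"
proof -
  note inv = minv_inverse[OF set_mat_carrier assms(2)]
  obtain w where w: "minv (set_mat k A A) = set_mat w A A"
    using ex_set_mat[OF assms(1) assms(1) inv(1)] .
  have "set_mat (\<lambda>a c. \<Sum>b\<in>A. k a b * w b c) A A = set_mat (\<lambda>a b. of_bool (a = b)) A A"
    "set_mat (\<lambda>a c. \<Sum>b\<in>A. w a b * k b c) A A = set_mat (\<lambda>a b. of_bool (a = b)) A A"
    using inv(2,3) one_mat_eq_set_mat[OF assms(1)] by (simp_all add: w set_mat_mult[OF assms(1)])
  from set_mat_eqD[OF this(1) assms(1) assms(1)] set_mat_eqD[OF this(2) assms(1) assms(1)]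
  show thesis using that[OF w] by blast
qed

text \<open>Two enumerations of a set differ by a permutation that acts on rows and columns alike,
  so its sign occurs twice and cancels.\<close>

lemma det_enumeration:
  assumes "distinct xs" "set xs = A"
  shows "det (set_mat k A A) = det (mat (length xs) (length xs) (\<lambda>(i, j). k (xs ! i) (xs ! j)))"
proof -
  have fin: "finite A" using assms(2) by auto
  note E = enum_set_properties[OF fin]
  define n where "n = card A"
  have n: "length xs = n" using assms distinct_card n_def by metis
  have "mset (enum_set A) = mset xs"
    using E assms by (metis set_eq_iff_mset_eq_distinct)
  then obtain p where p: "p permutes {..<length xs}" "permute_list p xs = enum_set A"
    by (rule mset_eq_permutation)
  have p0: "p permutes {0..<n}" using p(1) n by (simp add: lessThan_atLeast0)
  have nth: "enum_set A ! i = xs ! (p i)" if "i < n" for i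
    using p n that permute_list_nth by metis
  have pl: "p i < n" if "i < n" for i
    using permutes_in_image[OF p0, of i] that by simp
  define B where "B = mat n n (\<lambda>(i, j). k (xs ! i) (xs ! j))"
  \<comment> \<open>\<open>C\<close> is the transpose of \<open>B\<close> with permuted rows, so its
    transpose is \<open>B\<close> with permuted columns. Permuting the rows of that transpose then
    gives the matrix over \<open>enum_set A\<close>.\<close>
  define C where "C = mat n n (\<lambda>(i, j). transpose_mat B $$ (p i, j))"
  have B: "B \<in> carrier_mat n n" "transpose_mat B \<in> carrier_mat n n" by (simp_all add: B_def)
  have C: "C \<in> carrier_mat n n" "transpose_mat C \<in> carrier_mat n n" by (simp_all add: C_def)
  have "set_mat k A A = mat n n (\<lambda>(i, j). transpose_mat C $$ (p i, j))"
    using pl by (intro eq_matI) (auto simp: set_mat_index nth C_def B_def n_def)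
  then have "det (set_mat k A A) = signof p * (signof p * det B)"
    using det_permute_rows[OF C(2) p0] det_permute_rows[OF B(2) p0] det_transpose[OF C(1)]
      det_transpose[OF B(1)] by (simp add: C_def)
  also have "\<dots> = det B" by (auto simp: sign_def)
  finally show ?thesis by (simp add: B_def n)
qed

section \<open>Positive definite kernels\<close>

definition quad :: "('a \<Rightarrow> 'a \<Rightarrow> real) \<Rightarrow> 'a set \<Rightarrow> ('a \<Rightarrow> real) \<Rightarrow> real" where
  "quad k A c = (\<Sum>a\<in>A. \<Sum>b\<in>A. c a * c b * k a b)"

definition psd_on :: "('a \<Rightarrow> 'a \<Rightarrow> real) \<Rightarrow> 'a set \<Rightarrow> bool" where
  "psd_on k A \<longleftrightarrow> (\<forall>c. quad k A c \<ge> 0)"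

definition pd_on :: "('a \<Rightarrow> 'a \<Rightarrow> real) \<Rightarrow> 'a set \<Rightarrow> bool" where
  "pd_on k A \<longleftrightarrow> (\<forall>c. (\<exists>a\<in>A. c a \<noteq> 0) \<longrightarrow> quad k A c > 0)"

text \<open>For symmetric positive definite \<open>k\<close> and \<open>y\<close> outside
  \<open>A\<close>, this is the variance of the Gaussian coordinate \<open>y\<close> given those in
  \<open>A\<close>, that is, a Schur complement. Written as a ratio of determinants, it makes
  determinants telescope when elements are inserted one by one.\<close>

definition cond_var :: "('a \<Rightarrow> 'a \<Rightarrow> real) \<Rightarrow> 'a set \<Rightarrow> 'a \<Rightarrow> real" where
  "cond_var k A y = det (set_mat k (insert y A) (insert y A)) / det (set_mat k A A)"

lemma quad_mono_set:
  assumes "finite B" "A \<subseteq> B" "\<And>b. b \<in> B - A \<Longrightarrow> c b = 0"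
  shows "quad k B c = quad k A c"
proof -
  have "quad k B c = (\<Sum>a\<in>A. \<Sum>b\<in>B. c a * c b * k a b)"
    unfolding quad_def using assms by (intro sum.mono_neutral_right) auto
  also have "\<dots> = quad k A c"
    unfolding quad_def using assms by (intro sum.cong refl sum.mono_neutral_right) auto
  finally show ?thesis .
qed

lemma quad_cong:
  assumes "\<And>a. a \<in> A \<Longrightarrow> c a = c' a" "\<And>a b. a \<in> A \<Longrightarrow> b \<in> A \<Longrightarrow> k a b = k' a b"
  shows "quad k A c = quad k' A c'"
  unfolding quad_def using assms by (intro sum.cong) auto

lemma pd_on_subset:
  assumes "pd_on k B" "finite B" "A \<subseteq> B"
  shows "pd_on (k :: 'a \<Rightarrow> 'a \<Rightarrow> real) A"
  unfolding pd_on_def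
proof (intro allI impI)
  fix c :: "'a \<Rightarrow> real" assume c: "\<exists>a\<in>A. c a \<noteq> 0"
  define c' :: "'a \<Rightarrow> real" where "c' a = (if a \<in> A then c a else 0)" for a
  have "quad k B c' = quad k A c'" using assms by (intro quad_mono_set) (auto simp: c'_def)
  also have "\<dots> = quad k A c" by (intro quad_cong) (auto simp: c'_def)
  finally have "quad k A c = quad k B c'" ..
  moreover have "\<exists>a\<in>B. c' a \<noteq> 0" using c assms(3) by (auto simp: c'_def)
  ultimately show "quad k A c > 0" using assms(1) by (auto simp: pd_on_def)
qed

lemma pd_on_imp_psd_on: "pd_on k A \<Longrightarrow> psd_on k A"
  unfolding pd_on_def psd_on_def
proof
  fix c assume *: "\<forall>c. (\<exists>a\<in>A. c a \<noteq> 0) \<longrightarrow> quad k A c > 0"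
  show "0 \<le> quad k A c"
  proof (cases "\<exists>a\<in>A. c a \<noteq> 0")
    case True
    with * show ?thesis by (simp add: less_imp_le)
  next
    case False
    then show ?thesis by (simp add: quad_def)
  qed
qed

text \<open>A nonzero vector in the null space would make the quadratic form vanish.\<close>

lemma pd_on_det_nonzero:
  assumes "finite A" "pd_on k A"
  shows "det (set_mat k A A) \<noteq> 0"
proof
  assume "det (set_mat k A A) = 0"
  then obtain v where v: "v \<in> carrier_vec (card A)" "v \<noteq> 0\<^sub>v (card A)"
    "set_mat k A A *\<^sub>v v = 0\<^sub>v (card A)"
    using det_0_iff_vec_prod_zero[OF set_mat_carrier] by metis
  \<comment> \<open>The null vector is viewed as a one-column matrix, so that
    \<open>ex_set_mat\<close> turns it into a function on \<open>A\<close>.\<close>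
  define M where "M = mat (card A) (card {()}) (\<lambda>(i, j). v $ i)"
  obtain c0 where c0: "M = set_mat c0 A {()}"
    using ex_set_mat[OF assms(1), of "{()}" M] by (auto simp: M_def)
  define c where "c a = c0 a ()" for a
  have c: "v $ i = c (enum_set A ! i)" if "i < card A" for i
  proof -
    have "v $ i = M $$ (i, 0)" using that by (simp add: M_def)
    then show ?thesis using that by (simp add: c0 set_mat_index c_def)
  qed
  have ker: "(\<Sum>b\<in>A. k a b * c b) = 0" if "a \<in> A" for a
  proof -
    obtain i where i: "i < card A" "enum_set A ! i = a" using enum_set_index assms(1) \<open>a \<in> A\<close> by metis
    have "0 = (set_mat k A A *\<^sub>v v) $ i" using v(3) i(1) by simp
    also have "\<dots> = (\<Sum>j<card A. k a (enum_set A ! j) * c (enum_set A ! j))"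
      using i v(1) c by (simp add: scalar_prod_def set_mat_index lessThan_atLeast0)
    also have "\<dots> = (\<Sum>b\<in>A. k a b * c b)"
      using sum_enum_set[OF assms(1), of "\<lambda>b. k a b * c b"] .
    finally show ?thesis ..
  qed
  have "\<exists>a\<in>A. c a \<noteq> 0"
  proof (rule ccontr)
    assume "\<not> (\<exists>a\<in>A. c a \<noteq> 0)"
    then have "v $ i = 0" if "i < card A" for i
      using c[OF that] enum_set_nth_mem[OF assms(1) that] by auto
    then have "v = 0\<^sub>v (card A)" using v(1) by (intro eq_vecI) auto
    with v(2) show False ..
  qed
  then have "quad k A c > 0" using assms(2) by (auto simp: pd_on_def)
  moreover have "quad k A c = (\<Sum>a\<in>A. c a * (\<Sum>b\<in>A. k a b * c b))"
    unfolding quad_def by (simp add: sum_distrib_left mult_ac)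
  ultimately show False using ker by simp
qed

text \<open>Eliminates the column of \<open>y\<close> with the solution \<open>c\<close> of the normal equations.\<close>
lemma det_insert_normal_eq:
  assumes A: "finite A" "y \<notin> A"
    and normal: "\<And>a. a \<in> A \<Longrightarrow> (\<Sum>b\<in>A. k a b * c b) = k a y"
  shows "det (set_mat k (insert y A) (insert y A))
    = det (set_mat k A A) * (k y y - (\<Sum>b\<in>A. k y b * c b))"
proof -
  define n where "n = card A"
  define e where "e = enum_set A"
  note E = enum_set_properties[OF A(1), folded e_def n_def]
  define col where "col = mat n 1 (\<lambda>(i, j). k (e ! i) y)"
  define row where "row = mat 1 n (\<lambda>(i, j). k y (e ! j))"
  define B where "B = set_mat k A A"
  define cc where "cc = mat n 1 (\<lambda>(i, j). - c (e ! i))"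
  define yy where "yy = mat 1 1 (\<lambda>(i, j). k y y)"
  define s where "s = mat 1 1 (\<lambda>(i, j). k y y - (\<Sum>b\<in>A. k y b * c b))"
  have carr: "B \<in> carrier_mat n n" "col \<in> carrier_mat n 1" "row \<in> carrier_mat 1 n"
    "cc \<in> carrier_mat n 1" "yy \<in> carrier_mat 1 1" "s \<in> carrier_mat 1 1"
    by (auto simp: B_def col_def row_def cc_def yy_def n_def s_def)
  have "distinct (e @ [y])" "set (e @ [y]) = insert y A" using E A by auto
  then have "det (set_mat k (insert y A) (insert y A))
     = det (mat (n + 1) (n + 1) (\<lambda>(i, j). k ((e @ [y]) ! i) ((e @ [y]) ! j)))"
    using det_enumeration[of "e @ [y]" "insert y A" k] E by simp
  also have "mat (n + 1) (n + 1) (\<lambda>(i, j). k ((e @ [y]) ! i) ((e @ [y]) ! j))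
    = four_block_mat B col row yy"
    using carr E by (intro eq_matI)
      (auto simp: B_def col_def row_def yy_def set_mat_index n_def[symmetric] e_def[symmetric] nth_append)
  finally have det1: "det (set_mat k (insert y A) (insert y A)) = det (four_block_mat B col row yy)" .
  have "B * cc + col * 1\<^sub>m 1 = 0\<^sub>m n 1"
  proof (intro eq_matI, goal_cases)
    case (1 i j)
    then have i: "i < n" "j = 0" by auto
    have "(B * cc) $$ (i, j) = (\<Sum>r<n. k (e ! i) (e ! r) * - c (e ! r))"
      using i carr by (simp add: B_def cc_def scalar_prod_def set_mat_index lessThan_atLeast0
          n_def[symmetric] e_def[symmetric])
    also have "\<dots> = (\<Sum>b\<in>A. k (e ! i) b * - c b)"
      using sum_enum_set[OF A(1), of "\<lambda>b. k (e ! i) b * - c b"] by (simp add: n_def e_def)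
    also have "\<dots> = - k (e ! i) y"
      using normal[of "e ! i"] E i by (simp add: sum_negf) (metis nth_mem)
    finally show ?case using i carr by (simp add: col_def)
  qed (use carr in auto)
  moreover have "row * cc + yy * 1\<^sub>m 1 = s"
  proof (intro eq_matI, goal_cases)
    case (1 i j)
    then have i: "i = 0" "j = 0" by (auto simp: s_def)
    have "(row * cc) $$ (i, j) = (\<Sum>r<n. k y (e ! r) * - c (e ! r))"
      using i carr by (simp add: row_def cc_def scalar_prod_def lessThan_atLeast0)
    also have "\<dots> = (\<Sum>b\<in>A. k y b * - c b)"
      using sum_enum_set[OF A(1), of "\<lambda>b. k y b * - c b"] by (simp add: n_def e_def)
    finally show ?case using i carr by (simp add: yy_def s_def sum_negf)
  qed (use carr in auto)
  moreover have "B * 1\<^sub>m n + col * 0\<^sub>m 1 n = B" "row * 1\<^sub>m n + yy * 0\<^sub>m 1 n = row"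
    using carr by auto
  ultimately have "four_block_mat B col row yy * four_block_mat (1\<^sub>m n) cc (0\<^sub>m 1 n) (1\<^sub>m 1)
     = four_block_mat B (0\<^sub>m n 1) row s"
    using mult_four_block_mat[of B n n col 1 row 1 yy "1\<^sub>m n" n cc 1 "0\<^sub>m 1 n" "1\<^sub>m 1"] carr by simp
  then have "det (four_block_mat B col row yy) * det (four_block_mat (1\<^sub>m n) cc (0\<^sub>m 1 n) (1\<^sub>m 1))
    = det (four_block_mat B (0\<^sub>m n 1) row s)"
    using det_mult[OF four_block_carrier_mat[OF carr(1,5)]
        four_block_carrier_mat[OF one_carrier_mat one_carrier_mat], of col row cc "0\<^sub>m 1 n"] by simp
  moreover have "det (four_block_mat (1\<^sub>m n) cc (0\<^sub>m 1 n) (1\<^sub>m 1)) = 1"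
    using det_four_block_mat_lower_left_zero[of "1\<^sub>m n" n cc 1 "0\<^sub>m 1 n" "1\<^sub>m 1"] carr by simp
  moreover have "det (four_block_mat B (0\<^sub>m n 1) row s) = det B * det s"
    using det_four_block_mat_upper_right_zero[of B n "0\<^sub>m n 1" 1 row s] carr by simp
  moreover have "det s = k y y - (\<Sum>b\<in>A. k y b * c b)"
    using det_single[of s] carr by (simp add: s_def)
  ultimately show ?thesis using det1 by (simp add: B_def)
qed

text \<open>The solution is the inverse kernel applied to \<open>g\<close>.\<close>

lemma normal_eq_solvable:
  assumes "finite A" "pd_on k A"
  obtains c where "\<And>a. a \<in> A \<Longrightarrow> (\<Sum>b\<in>A. k a b * c b) = g a"
proof -
  obtain w where w: "\<And>a c. a \<in> A \<Longrightarrow> c \<in> A \<Longrightarrow> (\<Sum>b\<in>A. k a b * w b c) = of_bool (a = c)"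
    using minv_set_mat[OF assms(1) pd_on_det_nonzero[OF assms]] by metis
  have "(\<Sum>b\<in>A. k a b * (\<Sum>d\<in>A. w b d * g d)) = g a" if a: "a \<in> A" for a
  proof -
    have "(\<Sum>b\<in>A. k a b * (\<Sum>d\<in>A. w b d * g d)) = (\<Sum>d\<in>A. (\<Sum>b\<in>A. k a b * w b d) * g d)"
      unfolding sum_distrib_left sum_distrib_right by (subst sum.swap) (simp add: mult_ac)
    also have "\<dots> = (\<Sum>d\<in>A. if a = d then g d else 0)"
      using w[OF a] by (intro sum.cong) auto
    finally show ?thesis using a assms(1) by simp
  qed
  then show thesis by (rule that)
qed

text \<open>The double sum of \<open>w a u * k a b * w b v\<close> is evaluated twice: summing over
  \<open>b\<close> first leaves \<open>w v u\<close>, summing over \<open>a\<close> first leaves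
  \<open>w u v\<close>.\<close>

lemma inverse_kernel_symmetric:
  assumes "finite A" and sym: "\<And>a b. a \<in> A \<Longrightarrow> b \<in> A \<Longrightarrow> k a b = k b a"
    and w: "\<And>a c. a \<in> A \<Longrightarrow> c \<in> A \<Longrightarrow> (\<Sum>b\<in>A. k a b * w b c) = of_bool (a = c)"
    and u: "u \<in> A" and v: "v \<in> A"
  shows "w u v = (w v u :: real)"
proof -
  have "(\<Sum>a\<in>A. w a u * (\<Sum>b\<in>A. k a b * w b v)) = (\<Sum>a\<in>A. if a = v then w a u else 0)"
    using w v by (intro sum.cong) auto
  then have 1: "(\<Sum>a\<in>A. w a u * (\<Sum>b\<in>A. k a b * w b v)) = w v u"
    using assms(1) v by simp
  have "(\<Sum>a\<in>A. w a u * (\<Sum>b\<in>A. k a b * w b v)) = (\<Sum>b\<in>A. (\<Sum>a\<in>A. k a b * w a u) * w b v)"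
    unfolding sum_distrib_left sum_distrib_right by (subst sum.swap) (simp add: mult_ac)
  also have "\<dots> = (\<Sum>b\<in>A. (\<Sum>a\<in>A. k b a * w a u) * w b v)"
    using sym by (intro sum.cong) auto
  also have "\<dots> = (\<Sum>b\<in>A. if b = u then w b v else 0)"
    using w u by (intro sum.cong) auto
  finally show ?thesis using 1 assms(1) u by simp
qed

lemma quad_insert:
  assumes "finite A" "y \<notin> A" and sym: "\<And>a. a \<in> A \<Longrightarrow> k a y = k y a"
  shows "quad k (insert y A) z = (z y)\<^sup>2 * k y y + 2 * z y * (\<Sum>a\<in>A. k y a * z a) + quad k A z"
proof -
  have "quad k (insert y A) z = (z y * z y * k y y + (\<Sum>b\<in>A. z y * z b * k y b))
    + (\<Sum>a\<in>A. z a * z y * k a y + (\<Sum>b\<in>A. z a * z b * k a b))"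
    unfolding quad_def using assms(1,2) by simp
  also have "(\<Sum>a\<in>A. z a * z y * k a y + (\<Sum>b\<in>A. z a * z b * k a b))
     = (\<Sum>a\<in>A. z y * z a * k y a) + quad k A z"
    using sym by (simp add: sum.distrib quad_def mult_ac)
  finally show ?thesis by (simp add: power2_eq_square sum_distrib_left mult_ac)
qed

lemma quad_add:
  assumes sym: "\<And>a b. a \<in> A \<Longrightarrow> b \<in> A \<Longrightarrow> k a b = k b a"
  shows "quad k A (\<lambda>a. z a + c a)
    = quad k A z + 2 * (\<Sum>a\<in>A. z a * (\<Sum>b\<in>A. k a b * c b)) + quad k A c"
proof -
  have "(\<Sum>a\<in>A. \<Sum>b\<in>A. c a * z b * k a b) = (\<Sum>b\<in>A. \<Sum>a\<in>A. c a * z b * k b a)"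
    by (subst sum.swap) (use sym in \<open>auto intro!: sum.cong\<close>)
  then have "(\<Sum>a\<in>A. \<Sum>b\<in>A. c a * z b * k a b) = (\<Sum>a\<in>A. z a * (\<Sum>b\<in>A. k a b * c b))"
    by (simp add: sum_distrib_left mult_ac)
  moreover have "(\<Sum>a\<in>A. \<Sum>b\<in>A. z a * c b * k a b) = (\<Sum>a\<in>A. z a * (\<Sum>b\<in>A. k a b * c b))"
    by (simp add: sum_distrib_left mult_ac)
  moreover have "quad k A (\<lambda>a. z a + c a) = quad k A z + (\<Sum>a\<in>A. \<Sum>b\<in>A. z a * c b * k a b)
     + (\<Sum>a\<in>A. \<Sum>b\<in>A. c a * z b * k a b) + quad k A c"
    unfolding quad_def by (simp add: sum.distrib algebra_simps)
  ultimately show ?thesis by simp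
qed

text \<open>Completing the square: the conditional variance is the minimum of the quadratic form over
  all vectors whose \<open>y\<close>-entry is 1.\<close>
lemma cond_var_minimum:
  assumes A: "finite A" "y \<notin> A" and pd: "pd_on k A"
    and sym: "\<And>a b. a \<in> insert y A \<Longrightarrow> b \<in> insert y A \<Longrightarrow> k a b = k b a"
  obtains c where "\<And>z. z y = 1 \<Longrightarrow>
    quad k (insert y A) z = cond_var k A y + quad k A (\<lambda>a. z a + c a)"
proof -
  obtain c where c: "\<And>a. a \<in> A \<Longrightarrow> (\<Sum>b\<in>A. k a b * c b) = k a y"
    using normal_eq_solvable[OF A(1) pd, of "\<lambda>a. k a y"] by blast
  have cv: "cond_var k A y = k y y - (\<Sum>b\<in>A. k y b * c b)"
    using det_insert_normal_eq[OF A c] pd_on_det_nonzero[OF A(1) pd] by (simp add: cond_var_def)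
  have "quad k (insert y A) z = cond_var k A y + quad k A (\<lambda>a. z a + c a)" if z: "z y = 1" for z
  proof -
    have *: "(\<Sum>a\<in>A. x a * (\<Sum>b\<in>A. k a b * c b)) = (\<Sum>a\<in>A. k y a * x a)" for x
      using c sym by (intro sum.cong) auto
    have "quad k A c = (\<Sum>a\<in>A. c a * (\<Sum>b\<in>A. k a b * c b))"
      by (simp add: quad_def sum_distrib_left mult_ac)
    then have "quad k A (\<lambda>a. z a + c a)
       = quad k A z + 2 * (\<Sum>a\<in>A. k y a * z a) + (\<Sum>a\<in>A. k y a * c a)"
      using quad_add[of A k z c] sym * by simp
    moreover have "quad k (insert y A) z = k y y + 2 * (\<Sum>a\<in>A. k y a * z a) + quad k A z"
      using quad_insert[OF A, of k z] sym z by simp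
    ultimately show ?thesis using cv by simp
  qed
  then show thesis by (rule that)
qed

lemma cond_var_le:
  assumes A: "finite A" "y \<notin> A" and pd: "pd_on k A"
    and sym: "\<And>a b. a \<in> insert y A \<Longrightarrow> b \<in> insert y A \<Longrightarrow> k a b = k b a"
    and z: "z y = 1"
  shows "cond_var k A y \<le> quad k (insert y A) z"
proof -
  obtain c where c: "\<And>z. z y = 1 \<Longrightarrow>
      quad k (insert y A) z = cond_var k A y + quad k A (\<lambda>a. z a + c a)"
    using cond_var_minimum[OF A pd sym] by metis
  have "quad k A (\<lambda>a. z a + c a) \<ge> 0" using pd_on_imp_psd_on[OF pd] by (simp add: psd_on_def)
  with c[of z] z show ?thesis by simp
qed

lemma cond_var_attained:
  assumes A: "finite A" "y \<notin> A" and pd: "pd_on k A"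
    and sym: "\<And>a b. a \<in> insert y A \<Longrightarrow> b \<in> insert y A \<Longrightarrow> k a b = k b a"
  obtains z where "z y = 1" "cond_var k A y = quad k (insert y A) z"
proof -
  obtain c where c: "\<And>z. z y = 1 \<Longrightarrow>
      quad k (insert y A) z = cond_var k A y + quad k A (\<lambda>a. z a + c a)"
    using cond_var_minimum[OF A pd sym] by metis
  define z where "z a = (if a = y then 1 else - c a)" for a
  have "quad k A (\<lambda>a. z a + c a) = quad k A (\<lambda>a. 0)"
    using A(2) by (intro quad_cong) (auto simp: z_def)
  then have "quad k A (\<lambda>a. z a + c a) = 0" by (simp add: quad_def)
  with c[of z] have "cond_var k A y = quad k (insert y A) z" by (simp add: z_def)
  moreover have "z y = 1" by (simp add: z_def)
  ultimately show thesis using that by blast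
qed

text \<open>The minimiser for \<open>A\<close>, extended by zeros, is a competitor in the minimum
  over \<open>B\<close>.\<close>

lemma cond_var_antimono:
  assumes B: "finite B" "y \<notin> B" "A \<subseteq> B" and pd: "pd_on k B"
    and sym: "\<And>a b. a \<in> insert y B \<Longrightarrow> b \<in> insert y B \<Longrightarrow> k a b = k b a"
  shows "cond_var k B y \<le> cond_var k A y"
proof -
  have A: "finite A" "y \<notin> A" using B finite_subset by auto
  obtain z where z: "z y = 1" "cond_var k A y = quad k (insert y A) z"
    using cond_var_attained[OF A pd_on_subset[OF pd B(1,3)], of thesis] sym B(3) by blast
  define z' where "z' a = (if a \<in> insert y A then z a else 0)" for a
  have "quad k (insert y B) z' = quad k (insert y A) z'"
    using B by (intro quad_mono_set) (auto simp: z'_def)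
  also have "\<dots> = quad k (insert y A) z"
    by (intro quad_cong) (auto simp: z'_def)
  finally show ?thesis
    using cond_var_le[OF B(1,2) pd sym, of z'] z by (simp add: z'_def)
qed

text \<open>The minimiser has \<open>y\<close>-entry 1, so the term of \<open>y\<close> in the lower
  bound already contributes \<open>n y\<close>.\<close>

lemma cond_var_ge:
  assumes A: "finite A" "y \<notin> A" and pd: "pd_on k A"
    and sym: "\<And>a b. a \<in> insert y A \<Longrightarrow> b \<in> insert y A \<Longrightarrow> k a b = k b a"
    and lower: "\<And>z. quad k (insert y A) z \<ge> (\<Sum>a\<in>insert y A. n a * (z a)\<^sup>2)"
    and n: "\<And>a. a \<in> A \<Longrightarrow> n a \<ge> 0"
  shows "cond_var k A y \<ge> n y"
proof -
  obtain z where z: "z y = 1" "cond_var k A y = quad k (insert y A) z"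
    using cond_var_attained[OF A pd sym] by metis
  have "(\<Sum>a\<in>A. n a * (z a)\<^sup>2) \<ge> 0" using n by (intro sum_nonneg) auto
  with lower[of z] z A show ?thesis by simp
qed

text \<open>Each inserted element multiplies the determinant by a conditional variance, which is
  positive as a value of the form at a vector with an entry 1.\<close>

lemma pd_on_det_pos:
  assumes "finite A" "pd_on k A"
    and sym: "\<And>a b. a \<in> A \<Longrightarrow> b \<in> A \<Longrightarrow> k a b = k b a"
  shows "det (set_mat k A A) > 0"
  using assms
proof (induction A rule: finite_induct)
  case empty
  then show ?case by (simp add: set_mat_def)
next
  case (insert y A)
  have pd: "pd_on k A" using insert by (intro pd_on_subset[OF insert.prems(1)]) auto
  then have det: "det (set_mat k A A) > 0" using insert by auto
  obtain z where "z y = 1" "cond_var k A y = quad k (insert y A) z"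
    using cond_var_attained[OF insert.hyps(1,2) pd insert.prems(2)] by metis
  then have "cond_var k A y > 0" using insert.prems(1) by (force simp: pd_on_def)
  with det show ?case by (simp add: cond_var_def zero_less_divide_iff)
qed

lemma cond_var_pos:
  assumes "finite A" "pd_on k (insert y A)"
    and sym: "\<And>a b. a \<in> insert y A \<Longrightarrow> b \<in> insert y A \<Longrightarrow> k a b = k b a"
  shows "cond_var k A y > 0"
proof -
  have "pd_on k A" using assms(1) by (intro pd_on_subset[OF assms(2)]) auto
  then show ?thesis
    using assms pd_on_det_pos[of "insert y A" k] pd_on_det_pos[of A k] by (simp add: cond_var_def)
qed

section \<open>Determinants of block matrices\<close>

text \<open>A solution of the normal equations for \<open>y\<close> over \<open>A\<close>, extended
  by 0 on \<open>B\<close>, also solves those over \<open>A \<union> B\<close>. Inserting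
  \<open>y\<close> therefore multiplies both determinants by the same factor.\<close>

lemma det_Un_orthogonal:
  assumes "finite A" "finite B" "A \<inter> B = {}" and pd: "pd_on k (A \<union> B)"
    and orth: "\<And>a b. a \<in> A \<Longrightarrow> b \<in> B \<Longrightarrow> k a b = 0" "\<And>a b. a \<in> A \<Longrightarrow> b \<in> B \<Longrightarrow> k b a = 0"
  shows "det (set_mat k (A \<union> B) (A \<union> B)) = det (set_mat k A A) * det (set_mat k B B)"
  using assms(1,3-)
proof (induction A rule: finite_induct)
  case empty
  then show ?case by (simp add: set_mat_def)
next
  case (insert y A)
  have fin: "finite (A \<union> B)" using insert assms(2) by auto
  have pd': "pd_on k (A \<union> B)" by (rule pd_on_subset[OF insert.prems(2)]) (use fin in auto)
  have pdA: "pd_on k A" by (rule pd_on_subset[OF pd']) (use fin in auto)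
  have IH: "det (set_mat k (A \<union> B) (A \<union> B)) = det (set_mat k A A) * det (set_mat k B B)"
    using insert pd' by auto
  obtain c where c: "\<And>a. a \<in> A \<Longrightarrow> (\<Sum>b\<in>A. k a b * c b) = k a y"
    using normal_eq_solvable[OF insert.hyps(1) pdA, of "\<lambda>a. k a y"] by blast
  define c' where "c' b = (if b \<in> A then c b else 0)" for b
  have sum_c': "(\<Sum>b\<in>A \<union> B. k a b * c' b) = (\<Sum>b\<in>A. k a b * c b)" for a
  proof -
    have "(\<Sum>b\<in>A \<union> B. k a b * c' b) = (\<Sum>b\<in>A. k a b * c' b)"
      using fin by (intro sum.mono_neutral_right) (auto simp: c'_def)
    then show ?thesis by (simp add: c'_def)
  qed
  have normal: "(\<Sum>b\<in>A \<union> B. k a b * c' b) = k a y" if "a \<in> A \<union> B" for a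
  proof (cases "a \<in> A")
    case True
    then show ?thesis using sum_c' c by simp
  next
    case False
    then have "a \<in> B" using that by auto
    then have "k a y = 0" "(\<Sum>b\<in>A. k a b * c b) = 0"
      using insert.prems(4) by (auto intro!: sum.neutral)
    then show ?thesis using sum_c' by simp
  qed
  have "y \<notin> A \<union> B" using insert by auto
  from det_insert_normal_eq[OF fin this normal]
  have "det (set_mat k (insert y (A \<union> B)) (insert y (A \<union> B)))
    = det (set_mat k (A \<union> B) (A \<union> B)) * (k y y - (\<Sum>b\<in>A. k y b * c b))"
    by (simp add: sum_c')
  moreover have "det (set_mat k (insert y A) (insert y A))
    = det (set_mat k A A) * (k y y - (\<Sum>b\<in>A. k y b * c b))"
    using det_insert_normal_eq[OF insert.hyps(1,2) c] .
  ultimately show ?case using IH by simp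
qed

text \<open>Sylvester's determinant identity, from the two block factorisations of
  the matrix with rows \<open>(S, C)\<close> and \<open>(-B, L)\<close>.\<close>
lemma det_sylvester:
  assumes S: "S \<in> carrier_mat n n" and L: "L \<in> carrier_mat m m"
    and B: "B \<in> carrier_mat m n" and C: "C \<in> carrier_mat n m"
    and nz: "det S \<noteq> 0" "det L \<noteq> 0"
  shows "det (S + C * minv L * B) * det L = det S * det (B * minv S * C + L)"
proof -
  note invS = minv_inverse[OF S nz(1)] and invL = minv_inverse[OF L nz(2)]
  define M where "M = four_block_mat S C (- B) L"
  have M: "M \<in> carrier_mat (n + m) (n + m)" using S L by (simp add: M_def)
  \<comment> \<open>Unit triangular matrices act on \<open>M\<close> by column operations:
    \<open>E1\<close> clears the lower left block using the columns of \<open>L\<close>, and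
    \<open>E2\<close> the upper right block using those of \<open>S\<close>.\<close>
  define E1 where "E1 = four_block_mat (1\<^sub>m n) (0\<^sub>m n m) (minv L * B) (1\<^sub>m m)"
  define E2 where "E2 = four_block_mat (1\<^sub>m n) (- (minv S * C)) (0\<^sub>m m n) (1\<^sub>m m)"
  have E: "E1 \<in> carrier_mat (n + m) (n + m)" "E2 \<in> carrier_mat (n + m) (n + m)"
    by (simp_all add: E1_def E2_def)
  have c1: "minv L * B \<in> carrier_mat m n" "- (minv S * C) \<in> carrier_mat n m" "- B \<in> carrier_mat m n"
    using B C invS invL by auto
  have "C * (minv L * B) = C * minv L * B" using assoc_mult_mat[OF C invL(1) B] by simp
  moreover have "L * (minv L * B) = B" using assoc_mult_mat[OF L invL(1) B] invL(2) B by simp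
  moreover have "- B + B = 0\<^sub>m m n" using B by auto
  ultimately have "M * E1 = four_block_mat (S + C * minv L * B) C (0\<^sub>m m n) L"
    unfolding M_def E1_def using S L B C c1
    by (subst mult_four_block_mat[of _ n n _ m _ m _ _ n _ m]) auto
  then have "det (M * E1) = det (S + C * minv L * B) * det L"
    using det_four_block_mat_lower_left_zero[of "S + C * minv L * B" n C m "0\<^sub>m m n" L] S L B C invL
    by simp
  moreover have "det E1 = 1"
    unfolding E1_def
    using det_four_block_mat_upper_right_zero[of "1\<^sub>m n" n "0\<^sub>m n m" m "minv L * B" "1\<^sub>m m"] c1 by simp
  ultimately have 1: "det M = det (S + C * minv L * B) * det L"
    using det_mult[OF M E(1)] by simp
  have "S * (- (minv S * C)) = - C"
    using assoc_mult_mat[OF S invS(1) C] invS(2) C S invS(1) by simp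
  moreover have "- C + C = 0\<^sub>m n m" using C by auto
  moreover have "(- B) * (- (minv S * C)) = B * minv S * C"
    using assoc_mult_mat[OF B invS(1) C] B C invS(1) by simp
  ultimately have "M * E2 = four_block_mat S (0\<^sub>m n m) (- B) (B * minv S * C + L)"
    unfolding M_def E2_def using S L B C c1
    by (subst mult_four_block_mat[of _ n n _ m _ m _ _ n _ m]) auto
  then have "det (M * E2) = det S * det (B * minv S * C + L)"
    using det_four_block_mat_upper_right_zero[of S n "0\<^sub>m n m" m "- B" "B * minv S * C + L"] S L B C invS
    by simp
  moreover have "det E2 = 1"
    unfolding E2_def
    using det_four_block_mat_lower_left_zero[of "1\<^sub>m n" n "- (minv S * C)" m "0\<^sub>m m n" "1\<^sub>m m"] c1 by simp
  ultimately have "det M = det S * det (B * minv S * C + L)"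
    using det_mult[OF M E(2)] by simp
  with 1 show ?thesis by simp
qed

section \<open>Schur complements and quadratic forms\<close>

text \<open>A lower bound for the joint form passes to the Schur complement of \<open>g\<close>: one
  evaluates the joint form at a suitable \<open>U\<close>-part. The second claim makes the
  subtracted form nonnegative whenever \<open>g\<close> is.\<close>

lemma schur_complement_quad:
  assumes U: "finite U"
    and joint: "\<And>z. quad k A c + 2 * (\<Sum>a\<in>A. \<Sum>u\<in>U. c a * z u * l a u) + quad g U z \<ge> n"
    and w: "\<And>a c. a \<in> U \<Longrightarrow> c \<in> U \<Longrightarrow> (\<Sum>b\<in>U. g a b * w b c) = of_bool (a = c)"
  shows "quad k A c - quad (\<lambda>a b. \<Sum>u\<in>U. \<Sum>v\<in>U. l a u * w u v * l b v) A c \<ge> n"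
    and "\<exists>z. quad (\<lambda>a b. \<Sum>u\<in>U. \<Sum>v\<in>U. l a u * w u v * l b v) A c = quad g U z"
proof -
  define \<beta> where "\<beta> u = (\<Sum>a\<in>A. c a * l a u)" for u
  \<comment> \<open>This choice solves the linear system \<open>g z = - \<beta>\<close>, so the
    cross term and the \<open>g\<close>-term together leave exactly \<open>- q\<close>.\<close>
  define z where "z u = - (\<Sum>v\<in>U. w u v * \<beta> v)" for u
  define q where "q = (\<Sum>u\<in>U. \<Sum>v\<in>U. \<beta> u * w u v * \<beta> v)"
  have gz: "(\<Sum>v\<in>U. g u v * z v) = - \<beta> u" if u: "u \<in> U" for u
  proof -
    have "(\<Sum>v\<in>U. g u v * z v) = - (\<Sum>x\<in>U. (\<Sum>v\<in>U. g u v * w v x) * \<beta> x)"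
      unfolding z_def sum_distrib_right sum_distrib_left
      by (subst sum.swap) (simp add: sum_distrib_left sum_negf mult_ac)
    also have "(\<Sum>x\<in>U. (\<Sum>v\<in>U. g u v * w v x) * \<beta> x) = (\<Sum>x\<in>U. if u = x then \<beta> x else 0)"
      using w u by (intro sum.cong) auto
    finally show ?thesis using u U by simp
  qed
  have zb: "(\<Sum>u\<in>U. z u * \<beta> u) = - q"
    unfolding z_def q_def by (simp add: sum_negf sum_distrib_left sum_distrib_right mult_ac)
  have "quad g U z = (\<Sum>u\<in>U. z u * (\<Sum>v\<in>U. g u v * z v))"
    by (simp add: quad_def sum_distrib_left mult_ac)
  also have "\<dots> = (\<Sum>u\<in>U. - (z u * \<beta> u))" using gz by (intro sum.cong) auto
  also have "\<dots> = q" using zb by (simp add: sum_negf)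
  finally have qg: "quad g U z = q" .
  have "(\<Sum>a\<in>A. \<Sum>u\<in>U. c a * z u * l a u) = (\<Sum>u\<in>U. z u * \<beta> u)"
    unfolding \<beta>_def by (subst sum.swap) (simp add: sum_distrib_left mult_ac)
  then have cross: "(\<Sum>a\<in>A. \<Sum>u\<in>U. c a * z u * l a u) = - q" using zb by simp
  have "quad (\<lambda>a b. \<Sum>u\<in>U. \<Sum>v\<in>U. l a u * w u v * l b v) A c
    = (\<Sum>a\<in>A. \<Sum>b\<in>A. \<Sum>u\<in>U. \<Sum>v\<in>U. c a * l a u * w u v * (c b * l b v))"
    by (simp add: quad_def sum_distrib_left mult_ac)
  \<comment> \<open>The sums over \<open>A\<close> move inside those over \<open>U\<close>, where
    they factor into \<open>\<beta> u\<close> and \<open>\<beta> v\<close>.\<close>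
  also have "\<dots> = (\<Sum>a\<in>A. \<Sum>u\<in>U. \<Sum>b\<in>A. \<Sum>v\<in>U. c a * l a u * w u v * (c b * l b v))"
    by (intro sum.cong refl sum.swap)
  also have "\<dots> = (\<Sum>a\<in>A. \<Sum>u\<in>U. \<Sum>v\<in>U. \<Sum>b\<in>A. c a * l a u * w u v * (c b * l b v))"
    by (intro sum.cong refl sum.swap)
  also have "\<dots> = (\<Sum>u\<in>U. \<Sum>a\<in>A. \<Sum>v\<in>U. \<Sum>b\<in>A. c a * l a u * w u v * (c b * l b v))"
    by (rule sum.swap)
  also have "\<dots> = (\<Sum>u\<in>U. \<Sum>v\<in>U. \<Sum>a\<in>A. \<Sum>b\<in>A. c a * l a u * w u v * (c b * l b v))"
    by (intro sum.cong refl sum.swap)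
  also have "\<dots> = q"
    by (simp add: q_def \<beta>_def sum_distrib_left sum_distrib_right mult_ac)
  finally have quad_q: "quad (\<lambda>a b. \<Sum>u\<in>U. \<Sum>v\<in>U. l a u * w u v * l b v) A c = q" .
  with qg show "\<exists>z. quad (\<lambda>a b. \<Sum>u\<in>U. \<Sum>v\<in>U. l a u * w u v * l b v) A c = quad g U z"
    by metis
  show "quad k A c - quad (\<lambda>a b. \<Sum>u\<in>U. \<Sum>v\<in>U. l a u * w u v * l b v) A c \<ge> n"
    using joint[of z] qg cross quad_q by simp
qed

lemma quad_Un:
  assumes "finite A" "finite B" "A \<inter> B = {}"
    and sym: "\<And>a b. a \<in> A \<Longrightarrow> b \<in> B \<Longrightarrow> k a b = k b a"
  shows "quad k (A \<union> B) c = quad k A c + 2 * (\<Sum>b\<in>B. \<Sum>a\<in>A. c b * c a * k b a) + quad k B c"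
proof -
  have "(\<Sum>a\<in>A. \<Sum>b\<in>B. c a * c b * k a b) = (\<Sum>b\<in>B. \<Sum>a\<in>A. c b * c a * k b a)"
    by (subst sum.swap) (use sym in \<open>auto intro!: sum.cong\<close>)
  then show ?thesis
    unfolding quad_def using assms(1-3) by (simp add: sum.union_disjoint sum.distrib)
qed

lemma pd_on_of_noise:
  fixes k :: "'a \<Rightarrow> 'a \<Rightarrow> real"
  assumes "finite A" "\<And>a. a \<in> A \<Longrightarrow> n a > 0"
    and "\<And>c. quad k A c \<ge> (\<Sum>a\<in>A. n a * (c a)\<^sup>2)"
  shows "pd_on k A"
  unfolding pd_on_def
proof (intro allI impI)
  fix c :: "'a \<Rightarrow> real" assume "\<exists>a\<in>A. c a \<noteq> 0"
  then obtain a where a: "a \<in> A" "c a \<noteq> 0" by blast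
  have "0 < (\<Sum>a\<in>A. n a * (c a)\<^sup>2)"
    using assms(1,2) a by (intro sum_pos2[of _ a]) (auto simp: less_imp_le)
  with assms(3)[of c] show "0 < quad k A c" by linarith
qed

section \<open>Comparing determinants through conditional variances\<close>

lemma det_insert_cond_var:
  assumes "finite A" "pd_on k A"
  shows "det (set_mat k (insert y A) (insert y A)) = det (set_mat k A A) * cond_var k A y"
  using pd_on_det_nonzero[OF assms] by (simp add: cond_var_def)

text \<open>The minimiser for \<open>k\<close> is a competitor for \<open>l\<close>.\<close>

lemma cond_var_mono_kernel:
  assumes A: "finite A" "y \<notin> A" and pd: "pd_on k A" "pd_on l A"
    and sym: "\<And>a b. a \<in> insert y A \<Longrightarrow> b \<in> insert y A \<Longrightarrow> k a b = k b a"
      "\<And>a b. a \<in> insert y A \<Longrightarrow> b \<in> insert y A \<Longrightarrow> l a b = l b a"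
    and le: "\<And>c. quad l (insert y A) c \<le> quad k (insert y A) c"
  shows "cond_var l A y \<le> cond_var k A y"
proof -
  obtain z where z: "z y = 1" "cond_var k A y = quad k (insert y A) z"
    using cond_var_attained[OF A pd(1) sym(1)] by metis
  with cond_var_le[OF A pd(2) sym(2), of z] le[of z] show ?thesis by simp
qed

text \<open>Adding noise to the variables in \<open>B\<close> decreases the information that \<open>B\<close> carries on \<open>A\<close>.\<close>
lemma det_ratio_mono_kernel:
  assumes "finite A" "finite B" "A \<inter> B = {}" and pd: "pd_on k (A \<union> B)" "pd_on l (A \<union> B)"
    and sym: "\<And>a b. a \<in> A \<union> B \<Longrightarrow> b \<in> A \<union> B \<Longrightarrow> k a b = k b a"
      "\<And>a b. a \<in> A \<union> B \<Longrightarrow> b \<in> A \<union> B \<Longrightarrow> l a b = l b a"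
    and le: "\<And>c. quad l (A \<union> B) c \<le> quad k (A \<union> B) c"
  shows "det (set_mat k B B) * det (set_mat l (A \<union> B) (A \<union> B))
    \<le> det (set_mat l B B) * det (set_mat k (A \<union> B) (A \<union> B))"
  using assms(1,3-)
proof (induction A rule: finite_induct)
  case empty
  then show ?case by simp
next
  case (insert y A)
  have fin: "finite (A \<union> B)" "y \<notin> A \<union> B" using insert assms(2) by auto
  have un: "insert y A \<union> B = insert y (A \<union> B)" by auto
  have pd: "pd_on k (A \<union> B)" "pd_on l (A \<union> B)"
    using pd_on_subset[OF insert.prems(2)] pd_on_subset[OF insert.prems(3)] fin by auto
  have le: "quad l (A \<union> B) c \<le> quad k (A \<union> B) c" for c
  proof -
    define c' where "c' a = (if a \<in> A \<union> B then c a else 0)" for a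
    have "quad m (insert y (A \<union> B)) c' = quad m (A \<union> B) c" for m
    proof -
      have "quad m (insert y (A \<union> B)) c' = quad m (A \<union> B) c'"
        using fin by (intro quad_mono_set) (auto simp: c'_def)
      also have "\<dots> = quad m (A \<union> B) c" by (intro quad_cong) (auto simp: c'_def)
      finally show ?thesis .
    qed
    with insert.prems(6)[of c'] un show ?thesis by simp
  qed
  have IH: "det (set_mat k B B) * det (set_mat l (A \<union> B) (A \<union> B))
    \<le> det (set_mat l B B) * det (set_mat k (A \<union> B) (A \<union> B))"
    using insert pd le by auto
  have sym: "\<And>a b. a \<in> insert y (A \<union> B) \<Longrightarrow> b \<in> insert y (A \<union> B) \<Longrightarrow> k a b = k b a"
    "\<And>a b. a \<in> insert y (A \<union> B) \<Longrightarrow> b \<in> insert y (A \<union> B) \<Longrightarrow> l a b = l b a"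
    using insert.prems(4,5) un by auto
  have cv: "cond_var l (A \<union> B) y \<le> cond_var k (A \<union> B) y"
    using cond_var_mono_kernel[OF fin pd sym] insert.prems(6) un by simp
  have "pd_on l (insert y (A \<union> B))" using insert.prems(3) un by simp
  then have pos: "cond_var l (A \<union> B) y > 0"
    using cond_var_pos[OF fin(1), of l y] sym(2) by blast
  have "pd_on k B" "pd_on l B"
    using pd_on_subset[OF pd(1) fin(1), of B] pd_on_subset[OF pd(2) fin(1), of B] by auto
  then have "det (set_mat l B B) > 0" "det (set_mat k (A \<union> B) (A \<union> B)) > 0"
    using pd_on_det_pos[OF assms(2), of l] pd_on_det_pos[OF fin(1) pd(1)] sym by auto
  \<comment> \<open>Inserting \<open>y\<close> multiplies the left side by the conditional variance
    under \<open>l\<close> and the right side by the larger one under \<open>k\<close>.\<close>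
  then have "det (set_mat k B B) * det (set_mat l (A \<union> B) (A \<union> B)) * cond_var l (A \<union> B) y
    \<le> det (set_mat l B B) * det (set_mat k (A \<union> B) (A \<union> B)) * cond_var k (A \<union> B) y"
    using pos by (intro mult_mono[OF IH cv]) auto
  then show ?case
    unfolding un det_insert_cond_var[OF fin(1) pd(1)] det_insert_cond_var[OF fin(1) pd(2)]
    by (simp add: mult_ac)
qed

text \<open>Chain rule: the elements of \<open>Y\<close> are inserted one at a time, each
  multiplying the determinant by a conditional variance given \<open>S\<close> and its
  predecessors.\<close>

lemma det_Un_ge:
  assumes "finite Y" "finite S" "Y \<inter> S = {}" and pd: "pd_on k (Y \<union> S)"
    and sym: "\<And>a b. a \<in> Y \<union> S \<Longrightarrow> b \<in> Y \<union> S \<Longrightarrow> k a b = k b a"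
    and n: "n \<ge> 0" and bound: "\<And>Z y. Z \<subseteq> Y \<Longrightarrow> y \<in> Y - Z \<Longrightarrow> cond_var k (Z \<union> S) y \<ge> n"
  shows "det (set_mat k (Y \<union> S) (Y \<union> S)) \<ge> det (set_mat k S S) * n ^ card Y"
  using assms(1,3-5) bound
proof (induction Y rule: finite_induct)
  case empty
  then show ?case by simp
next
  case (insert y Y)
  have fin: "finite (Y \<union> S)" using insert assms(2) by auto
  have un: "insert y Y \<union> S = insert y (Y \<union> S)" by auto
  have pd: "pd_on k (Y \<union> S)" using pd_on_subset[OF insert.prems(2)] fin by auto
  have "det (set_mat k (Y \<union> S) (Y \<union> S)) \<ge> det (set_mat k S S) * n ^ card Y"
  proof (rule insert.IH)
    show "Y \<inter> S = {}" using insert.prems(1) by auto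
    show "pd_on k (Y \<union> S)" by (rule pd)
    show "k a b = k b a" if "a \<in> Y \<union> S" "b \<in> Y \<union> S" for a b
      using insert.prems(3)[of a b] that by simp
    show "cond_var k (Z \<union> S) x \<ge> n" if "Z \<subseteq> Y" "x \<in> Y - Z" for Z x
      using insert.prems(4)[of Z x] that by auto
  qed
  moreover have "cond_var k (Y \<union> S) y \<ge> n"
    using insert.prems(4)[of Y y] insert.hyps by auto
  moreover have "det (set_mat k (Y \<union> S) (Y \<union> S)) > 0"
    using pd_on_det_pos[OF fin pd] insert.prems(3) by auto
  ultimately have "(det (set_mat k S S) * n ^ card Y) * n
     \<le> det (set_mat k (Y \<union> S) (Y \<union> S)) * cond_var k (Y \<union> S) y"
    using n by (intro mult_mono) auto
  then show ?case
    using insert.hyps unfolding un det_insert_cond_var[OF fin pd] by (simp add: mult_ac)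
qed

text \<open>The same chain rule with upper bounds on the factors.\<close>

lemma det_Un_le:
  assumes "finite Y" "finite S" "Y \<inter> S = {}" and pd: "pd_on k (Y \<union> S)"
    and sym: "\<And>a b. a \<in> Y \<union> S \<Longrightarrow> b \<in> Y \<union> S \<Longrightarrow> k a b = k b a"
    and n: "n \<ge> 0" and bound: "\<And>Z y. Z \<subseteq> Y \<Longrightarrow> y \<in> Y - Z \<Longrightarrow> cond_var k (Z \<union> S) y \<le> n"
  shows "det (set_mat k (Y \<union> S) (Y \<union> S)) \<le> det (set_mat k S S) * n ^ card Y"
  using assms(1,3-5) bound
proof (induction Y rule: finite_induct)
  case empty
  then show ?case by simp
next
  case (insert y Y)
  have fin: "finite (Y \<union> S)" using insert assms(2) by auto
  have un: "insert y Y \<union> S = insert y (Y \<union> S)" by auto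
  have pd: "pd_on k (Y \<union> S)" using pd_on_subset[OF insert.prems(2)] fin by auto
  have "det (set_mat k (Y \<union> S) (Y \<union> S)) \<le> det (set_mat k S S) * n ^ card Y"
  proof (rule insert.IH)
    show "Y \<inter> S = {}" using insert.prems(1) by auto
    show "pd_on k (Y \<union> S)" by (rule pd)
    show "k a b = k b a" if "a \<in> Y \<union> S" "b \<in> Y \<union> S" for a b
      using insert.prems(3)[of a b] that by simp
    show "cond_var k (Z \<union> S) x \<le> n" if "Z \<subseteq> Y" "x \<in> Y - Z" for Z x
      using insert.prems(4)[of Z x] that by auto
  qed
  moreover have "cond_var k (Y \<union> S) y \<le> n"
    using insert.prems(4)[of Y y] insert.hyps by auto
  moreover have "det (set_mat k (Y \<union> S) (Y \<union> S)) > 0"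
    using pd_on_det_pos[OF fin pd] insert.prems(3) by auto
  moreover have "cond_var k (Y \<union> S) y > 0"
    using cond_var_pos[OF fin, of k y] insert.prems(2,3) un by simp
  ultimately have "det (set_mat k (Y \<union> S) (Y \<union> S)) * cond_var k (Y \<union> S) y
     \<le> (det (set_mat k S S) * n ^ card Y) * n"
    using n by (intro mult_mono) auto
  then show ?case
    using insert.hyps unfolding un det_insert_cond_var[OF fin pd] by (simp add: mult_ac)
qed

text \<open>The information that \<open>Y\<close> carries on \<open>S - T\<close> given \<open>T\<close> does not decrease if the conditional
  covariance of \<open>Y\<close> given \<open>S\<close> is replaced by its lower bound \<open>n\<close> times the identity. In the
  modified kernel \<open>l\<close> the elements of \<open>Y\<close> are conditionally independent given \<open>S\<close>.\<close>
lemma det_information_bound: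
  assumes fin: "finite Y" "finite S" and disj: "Y \<inter> S = {}" and T: "T \<subseteq> S"
    and pd: "pd_on k (Y \<union> S)"
    and sym: "\<And>a b. a \<in> Y \<union> S \<Longrightarrow> b \<in> Y \<union> S \<Longrightarrow> k a b = k b a"
    and n: "n > 0" and noise: "\<And>c. quad k (Y \<union> S) c \<ge> n * (\<Sum>y\<in>Y. (c y)\<^sup>2)"
    and \<delta>: "\<delta> \<ge> 0" "\<And>y. y \<in> Y \<Longrightarrow> cond_var k T y - cond_var k S y \<le> \<delta>"
  shows "det (set_mat k (Y \<union> T) (Y \<union> T)) * det (set_mat k S S) * n ^ card Y
    \<le> det (set_mat k T T) * det (set_mat k (Y \<union> S) (Y \<union> S)) * (n + \<delta>) ^ card Y"
proof -
  have finT: "finite T" using T fin finite_subset by auto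
  have pdS: "pd_on k S" and pdT: "pd_on k T"
    using pd_on_subset[OF pd] fin T by auto
  \<comment> \<open>\<open>h y\<close> holds the coefficients of the regression of \<open>y\<close>
    on \<open>S\<close>.\<close>
  define h where "h y = (SOME h. \<forall>s\<in>S. (\<Sum>r\<in>S. k s r * h r) = k s y)" for y
  have "\<exists>h. \<forall>s\<in>S. (\<Sum>r\<in>S. k s r * h r) = k s y" for y
  proof -
    obtain h where "\<And>s. s \<in> S \<Longrightarrow> (\<Sum>r\<in>S. k s r * h r) = k s y"
      by (rule normal_eq_solvable[OF fin(2) pdS, of "\<lambda>s. k s y"]) (rule that)
    then show ?thesis by (intro exI[of _ h]) simp
  qed
  from someI_ex[OF this]
  have h: "(\<Sum>r\<in>S. k s r * h y r) = k s y" if "s \<in> S" for y s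
    using that unfolding h_def by blast
  \<comment> \<open>For elements of \<open>Y\<close>, this is the covariance of their regressions on
    \<open>S\<close>, so \<open>k - \<gamma>\<close> is the conditional covariance of
    \<open>Y\<close> given \<open>S\<close>.\<close>
  define \<gamma> where "\<gamma> y x = (\<Sum>s\<in>S. k y s * h x s)" for y x
  have symS: "k a b = k b a" if "a \<in> S" "b \<in> S" for a b
    using sym[of a b] that by simp
  have \<gamma>_alt: "\<gamma> y x = (\<Sum>s\<in>S. \<Sum>r\<in>S. h y r * h x s * k s r)" if "y \<in> Y" for y x
  proof -
    have "k y s = (\<Sum>r\<in>S. k s r * h y r)" if "s \<in> S" for s
      using h[OF that, of y] sym[of y s] that \<open>y \<in> Y\<close> by simp
    then show ?thesis by (simp add: \<gamma>_def sum_distrib_left mult_ac)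
  qed
  have \<gamma>_sym: "\<gamma> y x = \<gamma> x y" if "y \<in> Y" "x \<in> Y" for x y
  proof -
    have "\<gamma> y x = (\<Sum>r\<in>S. \<Sum>s\<in>S. h y r * h x s * k s r)"
      unfolding \<gamma>_alt[OF that(1)] by (rule sum.swap)
    also have "\<dots> = (\<Sum>r\<in>S. \<Sum>s\<in>S. h x s * h y r * k r s)"
      by (intro sum.cong refl) (simp add: symS)
    finally show ?thesis unfolding \<gamma>_alt[OF that(2)] .
  qed
  \<comment> \<open>All covariances involving \<open>S\<close> are kept, and the conditional
    covariance of \<open>Y\<close> given \<open>S\<close> becomes \<open>n\<close> times the
    identity.\<close>
  define l where "l a b = (if a \<in> Y \<and> b \<in> Y then n * of_bool (a = b) + \<gamma> a b else k a b)" for a b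
  have l_sym: "l a b = l b a" if "a \<in> Y \<union> S" "b \<in> Y \<union> S" for a b
    using sym[OF that] \<gamma>_sym[of a b] by (simp add: l_def)
  \<comment> \<open>\<open>e c\<close> is the regression on \<open>S\<close> of the combination of
    \<open>Y\<close> with weights \<open>c\<close>.\<close>
  define e where "e c s = (\<Sum>y\<in>Y. c y * h y s)" for c s
  have ke: "(\<Sum>r\<in>S. k s r * e c r) = (\<Sum>y\<in>Y. c y * k y s)" if s: "s \<in> S" for c s
  proof -
    have "(\<Sum>r\<in>S. k s r * e c r) = (\<Sum>y\<in>Y. c y * (\<Sum>r\<in>S. k s r * h y r))"
      unfolding e_def sum_distrib_left by (subst sum.swap) (simp add: mult_ac)
    also have "\<dots> = (\<Sum>y\<in>Y. c y * k y s)"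
      using h[OF s] sym s by (intro sum.cong) auto
    finally show ?thesis .
  qed
  have lY: "quad l Y c = n * (\<Sum>y\<in>Y. (c y)\<^sup>2) + quad \<gamma> Y c" for c
  proof -
    have "quad l Y c = (\<Sum>a\<in>Y. \<Sum>b\<in>Y. (if a = b then n * (c a)\<^sup>2 else 0) + c a * c b * \<gamma> a b)"
      unfolding quad_def by (intro sum.cong) (auto simp: l_def power2_eq_square algebra_simps)
    also have "\<dots> = n * (\<Sum>y\<in>Y. (c y)\<^sup>2) + quad \<gamma> Y c"
      using fin(1) by (simp add: sum.distrib quad_def sum_distrib_left)
    finally show ?thesis .
  qed
  have \<gamma>Y: "quad \<gamma> Y c = quad k S (e c)" for c
  proof -
    have "quad k S (e c) = (\<Sum>s\<in>S. e c s * (\<Sum>r\<in>S. k s r * e c r))"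
      by (simp add: quad_def sum_distrib_left mult_ac)
    also have "\<dots> = (\<Sum>s\<in>S. e c s * (\<Sum>y\<in>Y. c y * k y s))" using ke by simp
    also have "\<dots> = (\<Sum>s\<in>S. \<Sum>y\<in>Y. c y * (e c s * k y s))"
      by (simp add: sum_distrib_left mult_ac)
    also have "\<dots> = (\<Sum>y\<in>Y. \<Sum>s\<in>S. c y * (e c s * k y s))" by (rule sum.swap)
    also have "\<dots> = (\<Sum>y\<in>Y. c y * (\<Sum>s\<in>S. \<Sum>x\<in>Y. c x * (k y s * h x s)))"
      by (simp add: e_def sum_distrib_left sum_distrib_right mult_ac)
    also have "\<dots> = (\<Sum>y\<in>Y. c y * (\<Sum>x\<in>Y. \<Sum>s\<in>S. c x * (k y s * h x s)))"
      by (intro sum.cong refl arg_cong2[of _ _ _ _ "(*)"] sum.swap)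
    also have "\<dots> = quad \<gamma> Y c"
      by (simp add: quad_def \<gamma>_def sum_distrib_left mult_ac)
    finally show ?thesis ..
  qed
  \<comment> \<open>Completing the square splits the form of \<open>l\<close> into the conditional
    noise of \<open>Y\<close> and a form on \<open>S\<close>, shifted by the regression.\<close>
  have quad_l: "quad l (Y \<union> S) c = n * (\<Sum>y\<in>Y. (c y)\<^sup>2) + quad k S (\<lambda>s. c s + e c s)" for c
  proof -
    have "quad l (S \<union> Y) c = quad l S c + 2 * (\<Sum>y\<in>Y. \<Sum>s\<in>S. c y * c s * l y s) + quad l Y c"
      using disj l_sym by (intro quad_Un fin) auto
    also have "quad l S c = quad k S c" using disj by (intro quad_cong) (auto simp: l_def)
    also have "(\<Sum>y\<in>Y. \<Sum>s\<in>S. c y * c s * l y s) = (\<Sum>y\<in>Y. \<Sum>s\<in>S. c y * c s * k y s)"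
      using disj by (intro sum.cong refl) (auto simp: l_def)
    also have "\<dots> = (\<Sum>s\<in>S. c s * (\<Sum>y\<in>Y. c y * k y s))"
      by (subst sum.swap) (simp add: sum_distrib_left mult_ac)
    also have "\<dots> = (\<Sum>s\<in>S. c s * (\<Sum>r\<in>S. k s r * e c r))" using ke by simp
    finally show ?thesis
      using quad_add[of S k c "e c", OF symS] by (simp add: lY \<gamma>Y Un_commute)
  qed
  have psdS: "quad k S c \<ge> 0" for c using pd_on_imp_psd_on[OF pdS] by (simp add: psd_on_def)
  have l_noise: "quad l (Y \<union> S) c \<ge> n * (\<Sum>y\<in>Y. (c y)\<^sup>2)" for c
    using quad_l psdS by simp
  have l_pd: "pd_on l (Y \<union> S)"
    unfolding pd_on_def
  proof (intro allI impI)
    fix c :: "'a \<Rightarrow> real" assume c: "\<exists>a\<in>Y \<union> S. c a \<noteq> 0"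
    show "quad l (Y \<union> S) c > 0"
    proof (cases "\<exists>y\<in>Y. c y \<noteq> 0")
      case True
      then have "(\<Sum>y\<in>Y. (c y)\<^sup>2) > 0"
        using fin(1) by (metis sum_pos2 zero_le_power2 zero_less_power2)
      then show ?thesis using n l_noise[of c] by (metis less_le_trans mult_pos_pos)
    next
      \<comment> \<open>If \<open>c\<close> vanishes on \<open>Y\<close>, so does
        \<open>e c\<close>, and only the form of \<open>k\<close> on \<open>S\<close>
        remains.\<close>
      case False
      then have "quad l (Y \<union> S) c = quad k S c" by (simp add: quad_l e_def)
      moreover have "\<exists>a\<in>S. c a \<noteq> 0" using c False by auto
      ultimately show ?thesis using pdS by (simp add: pd_on_def)
    qed
  qed
  have l_le: "quad l (Y \<union> S) c \<le> quad k (Y \<union> S) c" for c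
  proof -
    \<comment> \<open>The difference of the two forms depends only on the entries on
      \<open>Y\<close>, so the entries on \<open>S\<close> may be changed. With \<open>- e c\<close>
      there, the shifted form on \<open>S\<close> vanishes and the form of \<open>l\<close> equals
      the noise bound assumed for \<open>k\<close>.\<close>
    define b where "b a = (if a \<in> Y then c a else - e c a)" for a
    have "quad l (S \<union> Y) x - quad k (S \<union> Y) x = quad l Y x - quad k Y x" for x
    proof -
      have "quad l (S \<union> Y) x = quad l S x + 2 * (\<Sum>y\<in>Y. \<Sum>s\<in>S. x y * x s * l y s) + quad l Y x"
        using disj l_sym by (intro quad_Un fin) auto
      moreover have "quad k (S \<union> Y) x = quad k S x + 2 * (\<Sum>y\<in>Y. \<Sum>s\<in>S. x y * x s * k y s) + quad k Y x"
        using disj sym by (intro quad_Un fin) auto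
      moreover have "quad l S x = quad k S x" using disj by (intro quad_cong) (auto simp: l_def)
      moreover have "(\<Sum>y\<in>Y. \<Sum>s\<in>S. x y * x s * l y s) = (\<Sum>y\<in>Y. \<Sum>s\<in>S. x y * x s * k y s)"
        using disj by (intro sum.cong refl) (auto simp: l_def)
      ultimately show ?thesis by simp
    qed
    from this[of c] this[of b]
    have "quad l (Y \<union> S) c - quad k (Y \<union> S) c = quad l Y c - quad k Y c"
      "quad l (Y \<union> S) b - quad k (Y \<union> S) b = quad l Y b - quad k Y b"
      by (simp_all add: Un_commute)
    moreover have "quad m Y b = quad m Y c" for m by (intro quad_cong) (auto simp: b_def)
    moreover have "quad l (Y \<union> S) b = n * (\<Sum>y\<in>Y. (b y)\<^sup>2)"
    proof -
      have "e b = e c" by (auto simp: e_def b_def fun_eq_iff)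
      then have "quad k S (\<lambda>s. b s + e b s) = quad k S (\<lambda>s. 0)"
        using disj by (intro quad_cong) (auto simp: b_def)
      also have "\<dots> = 0" by (simp add: quad_def)
      finally show ?thesis by (simp add: quad_l)
    qed
    ultimately show ?thesis using noise[of b] by simp
  qed
  have lS: "set_mat l A A = set_mat k A A" if "A \<subseteq> S" for A
    using disj that fin(2) finite_subset by (intro set_mat_cong) (auto simp: l_def)
  have "n \<le> cond_var l (Z \<union> S) y" if Z: "Z \<subseteq> Y" "y \<in> Y - Z" for Z y
  proof -
    have finZ: "finite (Z \<union> S)" "y \<notin> Z \<union> S" "insert y (Z \<union> S) \<subseteq> Y \<union> S"
      using Z fin disj finite_subset by auto
    then have pdZ: "pd_on l (Z \<union> S)" using pd_on_subset[OF l_pd] fin by auto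
    have lsym: "l a b = l b a" if "a \<in> insert y (Z \<union> S)" "b \<in> insert y (Z \<union> S)" for a b
      using l_sym that finZ(3) by auto
    obtain z where z: "z y = 1" "cond_var l (Z \<union> S) y = quad l (insert y (Z \<union> S)) z"
      using cond_var_attained[OF finZ(1,2) pdZ lsym] by metis
    define z' where "z' a = (if a \<in> insert y (Z \<union> S) then z a else 0)" for a
    have "quad l (Y \<union> S) z' = quad l (insert y (Z \<union> S)) z'"
      using fin finZ by (intro quad_mono_set) (auto simp: z'_def)
    also have "\<dots> = quad l (insert y (Z \<union> S)) z" by (intro quad_cong) (auto simp: z'_def)
    finally have "cond_var l (Z \<union> S) y \<ge> n * (\<Sum>x\<in>Y. (z' x)\<^sup>2)" using l_noise[of z'] z by simp
    moreover have "(\<Sum>x\<in>Y. (z' x)\<^sup>2) \<ge> (z' y)\<^sup>2"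
      using Z fin(1) by (intro member_le_sum) auto
    then have "n * (\<Sum>x\<in>Y. (z' x)\<^sup>2) \<ge> n" using n z by (simp add: z'_def)
    ultimately show ?thesis by simp
  qed
  then have lower: "det (set_mat k S S) * n ^ card Y \<le> det (set_mat l (Y \<union> S) (Y \<union> S))"
    using det_Un_ge[OF fin disj l_pd l_sym] n lS[of S] by simp
  \<comment> \<open>The regression of \<open>y\<close> on \<open>T\<close> is the same under
    \<open>k\<close> and \<open>l\<close>, so the variance under \<open>l\<close> given
    \<open>T\<close> is \<open>n + cond_var k T y - cond_var k S y\<close>.\<close>
  have cvT: "cond_var l T y \<le> n + \<delta>" if y: "y \<in> Y" for y
  proof -
    have yS: "y \<notin> S" "y \<notin> T" using y disj T by auto
    obtain c where c: "\<And>a. a \<in> T \<Longrightarrow> (\<Sum>b\<in>T. k a b * c b) = k a y"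
      by (rule normal_eq_solvable[OF finT pdT, of "\<lambda>a. k a y"]) (rule that)
    have eq: "l a b = k a b" if "a \<in> T \<or> b \<in> T" for a b
      using that T disj by (auto simp: l_def)
    have "cond_var k T y = k y y - (\<Sum>b\<in>T. k y b * c b)"
      using det_insert_normal_eq[OF finT yS(2) c] pd_on_det_nonzero[OF finT pdT]
      by (simp add: cond_var_def)
    moreover have "(\<Sum>b\<in>T. l a b * c b) = l a y" if "a \<in> T" for a
      using c[OF that] eq that by simp
    then have "cond_var l T y = l y y - (\<Sum>b\<in>T. k y b * c b)"
      using det_insert_normal_eq[OF finT yS(2), of l c] pd_on_det_nonzero[OF finT pdT] eq lS[OF T]
      by (simp add: cond_var_def)
    moreover have "cond_var k S y = k y y - \<gamma> y y"
      using det_insert_normal_eq[OF fin(2) yS(1), of k "h y"] h pd_on_det_nonzero[OF fin(2) pdS]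
      by (simp add: cond_var_def \<gamma>_def)
    moreover have "l y y = n + \<gamma> y y" using y by (simp add: l_def)
    ultimately show ?thesis using \<delta>(2)[OF y] by simp
  qed
  have YT: "finite (Y \<union> T)" "Y \<union> T \<subseteq> Y \<union> S" "Y \<inter> T = {}" using fin finT T disj by auto
  have l_pdT: "pd_on l (Y \<union> T)" using pd_on_subset[OF l_pd] fin YT by auto
  have l_symT: "l a b = l b a" if "a \<in> Y \<union> T" "b \<in> Y \<union> T" for a b using l_sym that YT(2) by auto
  \<comment> \<open>Conditioning on further elements of \<open>Y\<close> can only lower the bound
    obtained for \<open>T\<close> alone.\<close>
  have "cond_var l (Z \<union> T) y \<le> n + \<delta>" if Z: "Z \<subseteq> Y" "y \<in> Y - Z" for Z y
  proof -
    have "finite (Z \<union> T)" "y \<notin> Z \<union> T" "insert y (Z \<union> T) \<subseteq> Y \<union> T"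
      using Z fin finT YT finite_subset by auto
    moreover from this have "pd_on l (Z \<union> T)" using pd_on_subset[OF l_pdT YT(1)] by auto
    ultimately have "cond_var l (Z \<union> T) y \<le> cond_var l T y"
      using l_symT by (intro cond_var_antimono) auto
    with cvT[of y] Z show ?thesis by auto
  qed
  then have upper: "det (set_mat l (Y \<union> T) (Y \<union> T)) \<le> det (set_mat k T T) * (n + \<delta>) ^ card Y"
    using det_Un_le[OF fin(1) finT YT(3) l_pdT l_symT, of "n + \<delta>"] n \<delta>(1) lS[OF T] by simp
  \<comment> \<open>The ratio comparison is applied with \<open>S - T\<close> as the predicted set
    and \<open>Y \<union> T\<close> as the conditioning set.\<close>
  have un: "(S - T) \<union> (Y \<union> T) = Y \<union> S" using T by auto
  have pos: "det (set_mat k (Y \<union> T) (Y \<union> T)) > 0" "det (set_mat k (Y \<union> S) (Y \<union> S)) > 0"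
    using pd_on_det_pos[OF YT(1) pd_on_subset[OF pd _ YT(2)]] pd_on_det_pos[of "Y \<union> S" k]
      fin pd sym YT(2) by auto
  have "det (set_mat k (Y \<union> T) (Y \<union> T)) * (det (set_mat k S S) * n ^ card Y)
    \<le> det (set_mat k (Y \<union> T) (Y \<union> T)) * det (set_mat l (Y \<union> S) (Y \<union> S))"
    using pos by (intro mult_left_mono lower) auto
  also have "\<dots> \<le> det (set_mat l (Y \<union> T) (Y \<union> T)) * det (set_mat k (Y \<union> S) (Y \<union> S))"
    using det_ratio_mono_kernel[of "S - T" "Y \<union> T" k l] un fin YT disj pd l_pd sym l_sym l_le by auto
  also have "\<dots> \<le> (det (set_mat k T T) * (n + \<delta>) ^ card Y) * det (set_mat k (Y \<union> S) (Y \<union> S))"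
    using pos by (intro mult_right_mono upper) auto
  finally show ?thesis by (simp only: mult_ac)
qed

section \<open>Gaussian kernels\<close>

text \<open>Parametrised by the variance, so that parameters add under convolution.\<close>

abbreviation ndens :: "real \<Rightarrow> real \<Rightarrow> real" where
  "ndens s \<equiv> normal_density 0 (sqrt s)"

text \<open>The convolution rule for centred normal densities, with integration variable
  \<open>u - y\<close> and the evenness of the density.\<close>

lemma ndens_convolution:
  assumes "s > 0" "t > 0"
  shows "has_bochner_integral lborel (\<lambda>u. ndens s (x - u) * ndens t (y - u)) (ndens (s + t) (x - y))"
proof (rule has_bochner_integral_nn_integral)
  have sym: "ndens t (u - y) = ndens t (y - u)" for u
    by (simp add: normal_density_def power2_commute)
  have "ennreal (ndens (s + t) (x - y))
    = (\<integral>\<^sup>+v. ennreal (ndens s (x - y - v) * ndens t v) \<partial>lborel)"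
    using fun_cong[OF conv_normal_density_zero_mean[of "sqrt s" "sqrt t"], of "x - y"] assms by simp
  also have "\<dots> = ennreal \<bar>1\<bar> * (\<integral>\<^sup>+u. ennreal (ndens s (x - y - (- y + 1 * u)) * ndens t (- y + 1 * u)) \<partial>lborel)"
    by (intro nn_integral_real_affine) auto
  also have "\<dots> = (\<integral>\<^sup>+u. ennreal (ndens s (x - u) * ndens t (y - u)) \<partial>lborel)"
    using sym by simp
  finally show "(\<integral>\<^sup>+u. ennreal (ndens s (x - u) * ndens t (y - u)) \<partial>lborel)
    = ennreal (ndens (s + t) (x - y))" ..
qed auto

text \<open>By the convolution identity the form is the integral over \<open>u\<close> of the form
  of \<open>G\<close> at the vector \<open>c i * ndens (s i) (x i - u)\<close>, which is nonnegative
  for every \<open>u\<close>.\<close>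

lemma psd_on_mult_ndens:
  assumes "finite I" and G: "psd_on G I" and s: "\<And>i. i \<in> I \<Longrightarrow> s i > 0"
  shows "psd_on (\<lambda>i j. G i j * ndens (s i + s j) (x i - x j)) I"
  unfolding psd_on_def
proof
  fix c
  have "has_bochner_integral lborel
     (\<lambda>u. \<Sum>i\<in>I. \<Sum>j\<in>I. c i * c j * G i j * (ndens (s i) (x i - u) * ndens (s j) (x j - u)))
     (\<Sum>i\<in>I. \<Sum>j\<in>I. c i * c j * G i j * ndens (s i + s j) (x i - x j))"
    using s by (intro has_bochner_integral_sum has_bochner_integral_mult_right ndens_convolution)
  moreover have "(\<lambda>u. \<Sum>i\<in>I. \<Sum>j\<in>I. c i * c j * G i j * (ndens (s i) (x i - u) * ndens (s j) (x j - u)))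
     = (\<lambda>u. quad G I (\<lambda>i. c i * ndens (s i) (x i - u)))"
    by (simp add: quad_def mult_ac)
  ultimately have "has_bochner_integral lborel (\<lambda>u. quad G I (\<lambda>i. c i * ndens (s i) (x i - u)))
     (quad (\<lambda>i j. G i j * ndens (s i + s j) (x i - x j)) I c)"
    by (simp add: quad_def mult_ac)
  then have "quad (\<lambda>i j. G i j * ndens (s i + s j) (x i - x j)) I c
     = (\<integral>u. quad G I (\<lambda>i. c i * ndens (s i) (x i - u)) \<partial>lborel)"
    by (rule has_bochner_integral_integral_eq[symmetric])
  also have "\<dots> \<ge> 0"
    using G by (intro Bochner_Integration.integral_nonneg) (simp add: psd_on_def)
  finally show "0 \<le> quad (\<lambda>i j. G i j * ndens (s i + s j) (x i - x j)) I c" .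
qed

lemma quad_one: "quad (\<lambda>i j. 1) I c = (\<Sum>i\<in>I. c i)\<^sup>2"
  by (simp add: quad_def power2_eq_square sum_product)

lemma psd_on_prod_ndens:
  fixes x :: "nat \<Rightarrow> 'i \<Rightarrow> real"
  assumes "finite I" and s: "\<And>i k. i \<in> I \<Longrightarrow> k < m \<Longrightarrow> s k i > 0"
  shows "psd_on (\<lambda>i j. \<Prod>k<m. ndens (s k i + s k j) (x k i - x k j)) I"
  using s
proof (induction m)
  case 0
  then show ?case by (simp add: psd_on_def quad_one)
next
  case (Suc m)
  then have "psd_on (\<lambda>i j. \<Prod>k<m. ndens (s k i + s k j) (x k i - x k j)) I" by simp
  from psd_on_mult_ndens[OF assms(1) this, of "s m" "x m"] Suc.prems show ?case by simp
qed

section \<open>Strict positivity of Gaussian kernels\<close>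

text \<open>Vanishing moments mean that \<open>a\<close> annihilates every polynomial in
  \<open>x\<close>. The polynomial with all other values of \<open>x\<close> on \<open>J\<close> as
  roots isolates the fibre over \<open>w\<close>.\<close>

lemma sum_eq_zero_on_fibre:
  fixes a x :: "'i \<Rightarrow> real"
  assumes "finite J" and moments: "\<And>n. (\<Sum>i\<in>J. a i * x i ^ n) = 0"
  shows "(\<Sum>i | i \<in> J \<and> x i = w. a i) = 0"
proof -
  have "\<forall>n. (\<Sum>i\<in>J. a i * (\<Prod>v\<in>W. x i - v) * x i ^ n) = 0" if "finite W" for W
    using that
  proof (induction W rule: finite_induct)
    case empty
    then show ?case using moments by simp
  next
    case (insert v W)
    show ?case
    proof
      fix n
      have "(\<Sum>i\<in>J. a i * (\<Prod>v\<in>insert v W. x i - v) * x i ^ n)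
         = (\<Sum>i\<in>J. a i * (\<Prod>v\<in>W. x i - v) * x i ^ Suc n)
           - v * (\<Sum>i\<in>J. a i * (\<Prod>v\<in>W. x i - v) * x i ^ n)"
        using insert.hyps unfolding sum_distrib_left sum_subtractf[symmetric]
        by (intro sum.cong) (auto simp: algebra_simps)
      then show "(\<Sum>i\<in>J. a i * (\<Prod>v\<in>insert v W. x i - v) * x i ^ n) = 0"
        using insert.IH by (simp del: power_Suc)
    qed
  qed
  from this[of "x ` J - {w}"] have "(\<Sum>i\<in>J. a i * (\<Prod>v\<in>x ` J - {w}. x i - v)) = 0"
    using assms(1) by (force dest: spec[of _ 0])
  also have "(\<Sum>i\<in>J. a i * (\<Prod>v\<in>x ` J - {w}. x i - v))
    = (\<Sum>i | i \<in> J \<and> x i = w. a i * (\<Prod>v\<in>x ` J - {w}. x i - v))"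
    using assms(1) by (intro sum.mono_neutral_right) auto
  also have "\<dots> = (\<Sum>i | i \<in> J \<and> x i = w. a i) * (\<Prod>v\<in>x ` J - {w}. w - v)"
    unfolding sum_distrib_right by (intro sum.cong) auto
  finally show ?thesis using assms(1) by auto
qed

text \<open>Expanding \<open>exp (x y / s)\<close> into its power series writes the quadratic form as a series of
  nonnegative terms, all of which vanish together with the sum.\<close>
lemma quad_mult_ndens_eq_0:
  assumes "finite I" and G: "psd_on G I" and s: "s > 0"
    and zero: "quad (\<lambda>i j. G i j * ndens s (x i - x j)) I c = 0"
  shows "quad G I (\<lambda>i. c i * exp (- (x i)\<^sup>2 / (2 * s)) * x i ^ n) = 0"
proof -
  define e where "e i = exp (- (x i)\<^sup>2 / (2 * s))" for i
  define C where "C = 1 / sqrt (2 * pi * s)"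
  have C: "C > 0" using s by (simp add: C_def)
  define q where "q n = quad G I (\<lambda>i. c i * e i * x i ^ n)" for n
  have dens: "ndens s (x i - x j) = C * e i * e j * exp (x i * x j / s)" for i j
  proof -
    have "- (x i - x j)\<^sup>2 / (2 * s) = - (x i)\<^sup>2 / (2 * s) + - (x j)\<^sup>2 / (2 * s) + x i * x j / s"
      using s by (simp add: field_simps power2_eq_square)
    then show ?thesis
      using s by (simp add: normal_density_def C_def e_def exp_add[symmetric])
  qed
  have "(\<lambda>n. \<Sum>i\<in>I. \<Sum>j\<in>I. c i * c j * G i j * (C * e i * e j)
        * ((x i * x j / s) ^ n /\<^sub>R fact n))
     sums (\<Sum>i\<in>I. \<Sum>j\<in>I. c i * c j * G i j * (C * e i * e j) * exp (x i * x j / s))"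
    by (intro sums_sum sums_mult exp_converges)
  moreover have "(\<Sum>i\<in>I. \<Sum>j\<in>I. c i * c j * G i j * (C * e i * e j) * ((x i * x j / s) ^ n /\<^sub>R fact n))
     = C / (s ^ n * fact n) * q n" for n
    unfolding q_def quad_def sum_distrib_left
    using s by (intro sum.cong refl) (simp add: field_simps power_mult_distrib power_divide)
  moreover have "(\<Sum>i\<in>I. \<Sum>j\<in>I. c i * c j * G i j * (C * e i * e j) * exp (x i * x j / s))
     = quad (\<lambda>i j. G i j * ndens s (x i - x j)) I c"
    by (simp add: quad_def dens mult_ac)
  ultimately have sums: "(\<lambda>n. C / (s ^ n * fact n) * q n) sums 0" using zero by simp
  have "q n \<ge> 0" for n using G by (simp add: q_def psd_on_def)
  then have nonneg: "C / (s ^ n * fact n) * q n \<ge> 0" for n using C s by simp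
  have "\<forall>n. C / (s ^ n * fact n) * q n = 0"
    using suminf_eq_zero_iff[OF sums_summable[OF sums] nonneg] sums_unique[OF sums] by simp
  then have "q n = 0" using C s by (metis divide_eq_0_iff fact_nonzero less_irrefl mult_eq_0_iff power_eq_0_iff)
  then show ?thesis by (simp add: q_def e_def)
qed

text \<open>Induction on the coordinates: if the form with one more factor vanishes, so do the forms
  with the earlier factors at \<open>c\<close> weighted by a positive function and any power of the
  last coordinate. Hence all moments on an earlier fibre vanish, and this fibre splits along the
  last coordinate.\<close>

lemma sum_fibre_eq_0_of_quad_eq_0:
  fixes x :: "nat \<Rightarrow> 'i \<Rightarrow> real"
  assumes "finite I" and s: "\<And>k. k < m \<Longrightarrow> s k > 0"
    and "quad (\<lambda>i j. \<Prod>k<m. ndens (s k) (x k i - x k j)) I c = 0"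
  shows "(\<Sum>i | i \<in> I \<and> (\<forall>k<m. x k i = y k). c i) = 0"
  using s assms(3)
proof (induction m arbitrary: c)
  case 0
  then show ?case by (simp add: quad_one)
next
  case (Suc m)
  let ?G = "\<lambda>i j. \<Prod>k<m. ndens (s k) (x k i - x k j)"
  let ?J = "{i \<in> I. \<forall>k<m. x k i = y k}"
  define e where "e i = exp (- (x m i)\<^sup>2 / (2 * s m))" for i
  have "psd_on ?G I"
    \<comment> \<open>Each argument receives half the variance, and the halves add up to
      \<open>s k\<close>.\<close>
    using psd_on_prod_ndens[OF assms(1), of m "\<lambda>k i. s k / 2" x] Suc.prems(1) by simp
  moreover have "quad (\<lambda>i j. ?G i j * ndens (s m) (x m i - x m j)) I c = 0"
    using Suc.prems(2) by simp
  ultimately have "quad ?G I (\<lambda>i. c i * e i * x m i ^ n) = 0" for n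
    unfolding e_def using Suc.prems(1) by (intro quad_mult_ndens_eq_0[OF assms(1)]) auto
  then have "(\<Sum>i\<in>?J. c i * e i * x m i ^ n) = 0" for n
    using Suc.IH Suc.prems(1) by (metis (lifting) less_SucI)
  then have "(\<Sum>i | i \<in> ?J \<and> x m i = y m. c i * e i) = 0"
    using assms(1) by (intro sum_eq_zero_on_fibre) auto
  moreover have "(\<Sum>i | i \<in> ?J \<and> x m i = y m. c i * e i)
    = (\<Sum>i | i \<in> ?J \<and> x m i = y m. c i) * exp (- (y m)\<^sup>2 / (2 * s m))"
    unfolding sum_distrib_right by (intro sum.cong) (auto simp: e_def)
  moreover have "{i. i \<in> ?J \<and> x m i = y m} = {i \<in> I. \<forall>k<Suc m. x k i = y k}"
    by (auto simp: less_Suc_eq)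
  ultimately show ?case by simp
qed

text \<open>Separated points have singleton fibres, so a vanishing form forces every coefficient to
  be 0. This makes \<open>Sigma_UU\<close> invertible.\<close>

lemma pd_on_prod_ndens:
  fixes x :: "nat \<Rightarrow> 'i \<Rightarrow> real"
  assumes I: "finite I" and s: "\<And>k. k < m \<Longrightarrow> s k > 0"
    and separated: "\<And>i j. i \<in> I \<Longrightarrow> j \<in> I \<Longrightarrow> (\<And>k. k < m \<Longrightarrow> x k i = x k j) \<Longrightarrow> i = j"
  shows "pd_on (\<lambda>i j. \<Prod>k<m. ndens (s k) (x k i - x k j)) I"
  unfolding pd_on_def
proof (intro allI impI)
  let ?G = "\<lambda>i j. \<Prod>k<m. ndens (s k) (x k i - x k j)"
  fix c :: "'i \<Rightarrow> real" assume "\<exists>a\<in>I. c a \<noteq> 0"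
  then obtain i where i: "i \<in> I" "c i \<noteq> 0" by blast
  have "{j \<in> I. \<forall>k<m. x k j = x k i} = {i}" using i separated by blast
  then have "quad ?G I c \<noteq> 0"
    using sum_fibre_eq_0_of_quad_eq_0[OF I, of m s x c "\<lambda>k. x k i"] s i by auto
  moreover have "quad ?G I c \<ge> 0"
    using psd_on_prod_ndens[OF I, of m "\<lambda>k i. s k / 2" x] s by (simp add: psd_on_def)
  ultimately show "quad ?G I c > 0" by simp
qed

section \<open>The convolved Gaussian process\<close>

lemma minv_mat_diag:
  assumes "\<And>k. k < d \<Longrightarrow> f k \<noteq> 0"
  shows "minv (mat_diag d f) = mat_diag d (\<lambda>k. 1 / f k)"
proof (rule minv_eqI)
  have "mat_diag d f * mat_diag d (\<lambda>k. 1 / f k) = mat_diag d (\<lambda>k. 1)"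
    unfolding mat_diag_diag unfolding mat_diag_def using assms by (intro eq_matI) auto
  then show "mat_diag d f * mat_diag d (\<lambda>k. 1 / f k) = 1\<^sub>m d" by simp
qed auto

lemma diagonal_mat_eq_mat_diag:
  assumes "A \<in> carrier_mat d d" "diagonal_mat A"
  shows "A = mat_diag d (\<lambda>k. A $$ (k, k))"
  using assms by (intro eq_matI) (auto simp: mat_diag_def diagonal_mat_def)

lemma mat_diag_add: "mat_diag d f + mat_diag d g = mat_diag d (\<lambda>k. f k + (g k :: real))"
  unfolding mat_diag_def by (intro eq_matI) auto

lemma det_mat_diag: "det (mat_diag d (f :: nat \<Rightarrow> real)) = (\<Prod>k<d. f k)"
proof -
  have "det (mat_diag d f) = prod_list (diag_mat (mat_diag d f))"
    by (intro det_upper_triangular[of _ d]) (auto simp: mat_diag_def)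
  also have "\<dots> = (\<Prod>k<d. f k)"
    by (simp add: prod_list_diag_prod mat_diag_def lessThan_atLeast0)
  finally show ?thesis .
qed

lemma sqrt_prod: "sqrt (\<Prod>k<d. f k) = (\<Prod>k<d. sqrt (f k))" for d :: nat
  by (induction d) (simp_all add: real_sqrt_mult)

lemma gauss_density_mat_diag:
  assumes z: "z \<in> carrier_vec d" and s: "\<And>k. k < d \<Longrightarrow> s k > 0"
  shows "gauss_density z (mat_diag d s) = (\<Prod>k<d. ndens (s k) (z $ k))"
proof -
  have "mat_diag d (\<lambda>k. 1 / s k) *\<^sub>v z = vec d (\<lambda>k. z $ k / s k)"
  proof (intro eq_vecI, goal_cases)
    case (1 i)
    then have i: "i < d" by simp
    have "(mat_diag d (\<lambda>k. 1 / s k) *\<^sub>v z) $ i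
      = (\<Sum>j\<in>{0..<d}. (if i = j then 1 / s j else 0) * z $ j)"
      using i z by (simp add: scalar_prod_def mat_diag_def)
    also have "\<dots> = (\<Sum>j\<in>{0..<d}. if i = j then z $ j / s j else 0)"
      by (intro sum.cong) auto
    finally show ?case using i by simp
  qed (auto simp: mat_diag_def)
  moreover have "minv (mat_diag d s) = mat_diag d (\<lambda>k. 1 / s k)"
    using s by (intro minv_mat_diag) (metis less_irrefl)
  ultimately have quad: "z \<bullet> (minv (mat_diag d s) *\<^sub>v z) = (\<Sum>k<d. (z $ k)\<^sup>2 / s k)"
    by (simp add: scalar_prod_def power2_eq_square lessThan_atLeast0)
  have "(\<Prod>k<d. ndens (s k) (z $ k))
    = (\<Prod>k<d. exp (- ((z $ k)\<^sup>2 / s k) / 2) / sqrt (2 * pi * s k))"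
    using s by (intro prod.cong) (auto simp: normal_density_def field_simps less_imp_le)
  also have "\<dots> = exp (\<Sum>k<d. - ((z $ k)\<^sup>2 / s k) / 2) / sqrt (\<Prod>k<d. 2 * pi * s k)"
    by (simp add: prod_dividef exp_sum sqrt_prod)
  also have "(\<Sum>k<d. - ((z $ k)\<^sup>2 / s k) / 2) = - (\<Sum>k<d. (z $ k)\<^sup>2 / s k) / 2"
    by (simp add: sum_negf sum_divide_distrib)
  also have "(\<Prod>k<d. 2 * pi * s k) = (2 * pi) ^ d * det (mat_diag d s)"
    by (simp add: prod.distrib det_mat_diag)
  finally show ?thesis
    using mat_diag_dim[of d s] by (simp only: gauss_density_def quad carrier_matD(1))
qed

section \<open>The covariance model and its joint positivity\<close>

locale pitc =
  fixes d M :: nat and D U :: "real vec set" and P :: "nat \<Rightarrow> real mat" and sv nv :: "nat \<Rightarrow> real"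
  assumes D: "D \<subseteq> carrier_vec d"
    and U: "finite U" "U \<subseteq> D"
    and P: "\<And>i. i \<in> {0..M} \<Longrightarrow>
          P i \<in> carrier_mat d d \<and> diagonal_mat (P i) \<and> (\<forall>k<d. P i $$ (k, k) > 0)"
    and sv: "\<And>i. i \<in> {1..M} \<Longrightarrow> sv i \<ge> 0"
    and nv: "\<And>i. i \<in> {1..M} \<Longrightarrow> nv i > 0"
begin

definition pvar :: "nat \<Rightarrow> nat \<Rightarrow> real" where
  "pvar i k = 1 / P i $$ (k, k)"

lemma pvar_pos: "i \<le> M \<Longrightarrow> k < d \<Longrightarrow> pvar i k > 0"
  using P[of i] by (simp add: pvar_def)

lemma minv_P: "i \<le> M \<Longrightarrow> minv (P i) = mat_diag d (pvar i)"
proof -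
  assume i: "i \<le> M"
  then have "P i = mat_diag d (\<lambda>k. P i $$ (k, k))" using P[of i] by (simp add: diagonal_mat_eq_mat_diag)
  then show ?thesis
    using minv_mat_diag[of d "\<lambda>k. P i $$ (k, k)"] P[of i] i unfolding pvar_def by fastforce
qed

abbreviation T :: "tuple set" where "T \<equiv> tuples M D"

lemma T_D: "(x, i) \<in> T \<longleftrightarrow> x \<in> D \<and> 1 \<le> i \<and> i \<le> M"
  by (auto simp: tuples_def)

text \<open>\<open>L\<close> and the noise-free measurements are smoothed copies of one white noise process. So,
  up to amplitudes, each covariance is a product over the coordinates of Gaussian densities with
  variance \<open>h + h'\<close>, where \<open>h\<close> is half the variance of \<open>L\<close> plus that of the convolution kernel.\<close>
definition feature_var :: "real vec + tuple \<Rightarrow> nat \<Rightarrow> real" where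
  "feature_var a k = (case a of Inl u \<Rightarrow> pvar 0 k / 2 | Inr (x, i) \<Rightarrow> pvar 0 k / 2 + pvar i k)"

definition location :: "real vec + tuple \<Rightarrow> nat \<Rightarrow> real" where
  "location a k = (case a of Inl u \<Rightarrow> u $ k | Inr (x, i) \<Rightarrow> x $ k)"

definition amplitude :: "real vec + tuple \<Rightarrow> real" where
  "amplitude a = (case a of Inl u \<Rightarrow> 1 | Inr (x, i) \<Rightarrow> sqrt (sv i))"

definition joint :: "real vec + tuple \<Rightarrow> real vec + tuple \<Rightarrow> real" where
  "joint a b = (\<Prod>k<d. ndens (feature_var a k + feature_var b k) (location a k - location b k))"

definition noise_free :: "tuple \<Rightarrow> tuple \<Rightarrow> real" where
  "noise_free a b = amplitude (Inr a) * amplitude (Inr b) * joint (Inr a) (Inr b)"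

lemma cov_LL_eq:
  assumes "u \<in> D" "v \<in> D"
  shows "cov_LL P u v = joint (Inl u) (Inl v)"
proof -
  have c: "u - v \<in> carrier_vec d" "u \<in> carrier_vec d" "v \<in> carrier_vec d"
    using assms D by (auto intro: minus_carrier_vec)
  have "cov_LL P u v = (\<Prod>k<d. ndens (pvar 0 k) ((u - v) $ k))"
    unfolding cov_LL_def using pvar_pos by (simp add: minv_P gauss_density_mat_diag[OF c(1)])
  then show ?thesis using c by (simp add: joint_def feature_var_def location_def)
qed

lemma cov_YL_eq:
  assumes "a \<in> T" "u \<in> D"
  shows "cov_YL P sv a u = amplitude (Inr a) * joint (Inr a) (Inl u)"
proof -
  obtain x i where a: "a = (x, i)" by (cases a)
  have i: "x \<in> D" "1 \<le> i" "i \<le> M" using assms(1) by (auto simp: a T_D)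
  have c: "x - u \<in> carrier_vec d" "x \<in> carrier_vec d" "u \<in> carrier_vec d"
    using assms(2) i D by (auto intro: minus_carrier_vec)
  have "cov_YL P sv a u = sqrt (sv i) * (\<Prod>k<d. ndens (pvar 0 k + pvar i k) ((x - u) $ k))"
    unfolding cov_YL_def using pvar_pos i
    by (simp add: a minv_P mat_diag_add gauss_density_mat_diag[OF c(1)] add_pos_pos)
  then show ?thesis
    using c by (simp add: a joint_def feature_var_def location_def amplitude_def algebra_simps)
qed

lemma cov_YY_eq:
  assumes "a \<in> T" "b \<in> T"
  shows "cov_YY P sv nv a b = noise_free a b + (if a = b then nv (snd a) else 0)"
proof -
  obtain x i where a: "a = (x, i)" by (cases a)
  obtain y j where b: "b = (y, j)" by (cases b)
  have i: "x \<in> D" "1 \<le> i" "i \<le> M" "y \<in> D" "1 \<le> j" "j \<le> M"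
    using assms by (auto simp: a b T_D)
  have c: "x - y \<in> carrier_vec d" "x \<in> carrier_vec d" "y \<in> carrier_vec d"
    using i D by (auto intro: minus_carrier_vec)
  have "gauss_density (x - y) (minv (P 0) + minv (P i) + minv (P j))
    = (\<Prod>k<d. ndens (pvar 0 k + pvar i k + pvar j k) ((x - y) $ k))"
    using pvar_pos i by (simp add: minv_P mat_diag_add gauss_density_mat_diag[OF c(1)] add_pos_pos)
  then have "cov_YY P sv nv a b = sqrt (sv i) * sqrt (sv j)
     * (\<Prod>k<d. ndens (pvar 0 k + pvar i k + pvar j k) ((x - y) $ k)) + (if a = b then nv i else 0)"
    unfolding cov_YY_def by (auto simp: a b)
  then show ?thesis
    using c by (simp add: a b joint_def noise_free_def feature_var_def location_def amplitude_def
        algebra_simps)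
qed

lemma joint_sym: "joint a b = joint b a"
  by (simp add: joint_def add.commute normal_density_def power2_commute)

lemma feature_var_pos: "a \<in> Inl ` U \<union> Inr ` T \<Longrightarrow> k < d \<Longrightarrow> feature_var a k > 0"
  using pvar_pos by (auto simp: feature_var_def T_D add_pos_pos)

text \<open>The inducing values and the noise-free measurements have a joint covariance, which is
  \<open>joint\<close> up to amplitudes and hence a product of Gaussian kernels.\<close>

lemma joint_quad_nonneg:
  assumes "finite A" "A \<subseteq> T"
  shows "quad noise_free A c + 2 * (\<Sum>a\<in>A. \<Sum>u\<in>U. c a * z u * cov_YL P sv a u)
    + quad (cov_LL P) U z \<ge> 0"
proof -
  \<comment> \<open>The amplitudes are absorbed into the coefficients.\<close>
  define y where "y a = (case a of Inl u \<Rightarrow> z u | Inr b \<Rightarrow> amplitude (Inr b) * c b)" for a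
  have "psd_on joint (Inl ` U \<union> Inr ` A)"
    unfolding joint_def[abs_def]
    using psd_on_prod_ndens[of "Inl ` U \<union> Inr ` A" d "\<lambda>k a. feature_var a k" "\<lambda>k a. location a k"]
      feature_var_pos assms U(1) by blast
  then have "quad joint (Inl ` U \<union> Inr ` A) y \<ge> 0" by (simp add: psd_on_def)
  also have "quad joint (Inl ` U \<union> Inr ` A) y = quad joint (Inl ` U) y
    + 2 * (\<Sum>b\<in>Inr ` A. \<Sum>a\<in>Inl ` U. y b * y a * joint b a) + quad joint (Inr ` A) y"
    using assms(1) U(1) joint_sym by (intro quad_Un) auto
  also have "quad joint (Inl ` U) y = quad (cov_LL P) U z"
    using U(2) by (auto simp: quad_def sum.reindex y_def cov_LL_eq subset_iff intro!: sum.cong)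
  also have "quad joint (Inr ` A) y = quad noise_free A c"
    by (simp add: quad_def sum.reindex y_def noise_free_def mult_ac)
  also have "(\<Sum>b\<in>Inr ` A. \<Sum>a\<in>Inl ` U. y b * y a * joint b a)
    = (\<Sum>a\<in>A. \<Sum>u\<in>U. c a * z u * cov_YL P sv a u)"
  proof -
    have "y (Inr a) * y (Inl u) * joint (Inr a) (Inl u) = c a * z u * cov_YL P sv a u"
      if "a \<in> A" "u \<in> U" for a u
    proof -
      have "a \<in> T" "u \<in> D" using that U(2) assms(2) by blast+
      then show ?thesis by (simp add: y_def cov_YL_eq)
    qed
    then show ?thesis by (simp add: sum.reindex)
  qed
  finally show ?thesis by simp
qed

lemma pd_on_cov_LL: "pd_on (cov_LL P) U"
proof -
  have "pd_on (\<lambda>u v. \<Prod>k<d. ndens (pvar 0 k) (u $ k - v $ k)) U"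
  proof (intro pd_on_prod_ndens[where x = "\<lambda>k u. u $ k"] U(1))
    fix u v assume "u \<in> U" "v \<in> U" and eq: "\<And>k. k < d \<Longrightarrow> u $ k = v $ k"
    then have "u \<in> carrier_vec d" "v \<in> carrier_vec d" using U D by auto
    then show "u = v" using eq by (intro eq_vecI) auto
  qed (use pvar_pos in auto)
  moreover have "quad (\<lambda>u v. \<Prod>k<d. ndens (pvar 0 k) (u $ k - v $ k)) U c = quad (cov_LL P) U c" for c
    using U(2) by (intro quad_cong)
      (auto simp: cov_LL_eq joint_def feature_var_def location_def subset_iff)
  ultimately show ?thesis by (simp add: pd_on_def)
qed

lemma cov_LL_sym: "u \<in> U \<Longrightarrow> v \<in> U \<Longrightarrow> cov_LL P u v = cov_LL P v u"
  using U(2) joint_sym[of "Inl u" "Inl v"] by (simp add: cov_LL_eq subset_iff)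

lemma det_Sigma_UU_pos: "det (Sigma_UU P U) > 0"
  unfolding Sigma_UU_def using U(1) pd_on_cov_LL cov_LL_sym by (rule pd_on_det_pos)

definition w :: "real vec \<Rightarrow> real vec \<Rightarrow> real" where
  "w = (SOME w. minv (Sigma_UU P U) = set_mat w U U)"

lemma minv_Sigma_UU: "minv (Sigma_UU P U) = set_mat w U U"
proof -
  have "\<exists>w. minv (Sigma_UU P U) = set_mat w U U"
    using minv_set_mat[OF U(1), of "cov_LL P"] pd_on_det_nonzero[OF U(1) pd_on_cov_LL]
    unfolding Sigma_UU_def by metis
  then show ?thesis unfolding w_def by (rule someI_ex)
qed

lemma w_inverse:
  assumes "u \<in> U" "v \<in> U"
  shows "(\<Sum>r\<in>U. cov_LL P u r * w r v) = of_bool (u = v)"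
proof -
  obtain w' where w': "minv (Sigma_UU P U) = set_mat w' U U"
    "\<And>u v. u \<in> U \<Longrightarrow> v \<in> U \<Longrightarrow> (\<Sum>r\<in>U. cov_LL P u r * w' r v) = of_bool (u = v)"
    using minv_set_mat[OF U(1), of "cov_LL P"] pd_on_det_nonzero[OF U(1) pd_on_cov_LL]
    unfolding Sigma_UU_def by metis
  have "w r v = w' r v" if "r \<in> U" for r
    using set_mat_eqD[of w U U w'] minv_Sigma_UU w'(1) U(1) that assms by simp
  then show ?thesis using w'(2)[OF assms] by simp
qed

section \<open>Kernels of the sparse model\<close>

definition \<gamma> :: "tuple \<Rightarrow> tuple \<Rightarrow> real" where
  "\<gamma> a b = (\<Sum>u\<in>U. \<Sum>v\<in>U. cov_YL P sv a u * w u v * cov_YL P sv b v)"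

definition residual :: "tuple \<Rightarrow> tuple \<Rightarrow> real" where
  "residual a b = cov_YY P sv nv a b - \<gamma> a b"

definition lam :: "tuple \<Rightarrow> tuple \<Rightarrow> real" where
  "lam a b = (if snd a = snd b then residual a b else 0)"

text \<open>The covariance of the measurements in the sparse model: exact within a type, and only
  the part explained by L_U across types.\<close>

definition K :: "tuple \<Rightarrow> tuple \<Rightarrow> real" where
  "K a b = \<gamma> a b + lam a b"

lemma Gam_eq: "Gam P sv U A B = set_mat \<gamma> A B"
proof -
  have "Gam P sv U A B = set_mat (\<lambda>a b. \<Sum>v\<in>U. (\<Sum>u\<in>U. cov_YL P sv a u * w u v) * cov_YL P sv b v) A B"
    unfolding Gam_def Sigma_AU_def minv_Sigma_UU by (simp add: set_mat_mult U(1) set_mat_transpose)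
  also have "(\<lambda>a b. \<Sum>v\<in>U. (\<Sum>u\<in>U. cov_YL P sv a u * w u v) * cov_YL P sv b v) = \<gamma>"
    unfolding \<gamma>_def fun_eq_iff sum_distrib_right by (intro allI sum.swap)
  finally show ?thesis .
qed

lemma Sigma_given_U_eq: "Sigma_given_U P sv nv U A = set_mat residual A A"
  unfolding Sigma_given_U_def Sigma_AA_def Gam_eq set_mat_minus residual_def[abs_def] ..

lemma Lam_eq: "Lam P sv nv U A = set_mat lam A A"
  unfolding Lam_def Sigma_given_U_eq lam_def
  by (intro eq_matI) (auto simp: set_mat_index)

lemma Gam_plus_Lam: "Gam P sv U A A + Lam P sv nv U A = set_mat K A A"
  unfolding Gam_eq Lam_eq set_mat_add K_def[abs_def] ..

lemma w_sym: "u \<in> U \<Longrightarrow> v \<in> U \<Longrightarrow> w u v = w v u"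
  using inverse_kernel_symmetric[OF U(1) cov_LL_sym w_inverse] by blast

lemma \<gamma>_sym: "\<gamma> a b = \<gamma> b a"
proof -
  have "\<gamma> a b = (\<Sum>v\<in>U. \<Sum>u\<in>U. cov_YL P sv a u * w u v * cov_YL P sv b v)"
    unfolding \<gamma>_def by (rule sum.swap)
  also have "\<dots> = \<gamma> b a"
    unfolding \<gamma>_def by (intro sum.cong refl) (simp add: w_sym)
  finally show ?thesis .
qed

lemma residual_sym: "a \<in> T \<Longrightarrow> b \<in> T \<Longrightarrow> residual a b = residual b a"
  using joint_sym \<gamma>_sym by (simp add: residual_def cov_YY_eq noise_free_def mult_ac)

lemma lam_sym: "a \<in> T \<Longrightarrow> b \<in> T \<Longrightarrow> lam a b = lam b a"
  using residual_sym by (simp add: lam_def)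

lemma K_sym: "a \<in> T \<Longrightarrow> b \<in> T \<Longrightarrow> K a b = K b a"
  unfolding K_def using lam_sym[of a b] \<gamma>_sym[of a b] by simp

lemma quad_\<gamma>_nonneg:
  assumes "finite A" "A \<subseteq> T"
  shows "quad \<gamma> A c \<ge> 0"
proof -
  have "\<exists>z. quad \<gamma> A c = quad (cov_LL P) U z"
    unfolding \<gamma>_def[abs_def] using joint_quad_nonneg[OF assms] w_inverse
    by (intro schur_complement_quad(2)[OF U(1)])
  then show ?thesis using pd_on_imp_psd_on[OF pd_on_cov_LL] by (auto simp: psd_on_def)
qed

text \<open>The Schur complement of the noise-free covariance is nonnegative, and the noise adds its
  diagonal.\<close>

lemma quad_residual_ge:
  assumes A: "finite A" "A \<subseteq> T"
  shows "quad residual A c \<ge> (\<Sum>a\<in>A. nv (snd a) * (c a)\<^sup>2)"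
proof -
  have "quad noise_free A c - quad \<gamma> A c \<ge> 0"
    unfolding \<gamma>_def[abs_def] using joint_quad_nonneg[OF A] w_inverse
    by (intro schur_complement_quad(1)[OF U(1)]) auto
  moreover have "quad residual A c = quad noise_free A c - quad \<gamma> A c + (\<Sum>a\<in>A. nv (snd a) * (c a)\<^sup>2)"
  proof -
    have "c a * c b * residual a b = c a * c b * noise_free a b - c a * c b * \<gamma> a b
        + (if a = b then nv (snd a) * (c a)\<^sup>2 else 0)" if "a \<in> A" "b \<in> A" for a b
    proof -
      have "a \<in> T" "b \<in> T" using that A(2) by auto
      then show ?thesis
        by (cases "a = b") (simp_all add: residual_def cov_YY_eq algebra_simps power2_eq_square)
    qed
    then have "quad residual A c = (\<Sum>a\<in>A. \<Sum>b\<in>A. c a * c b * noise_free a b - c a * c b * \<gamma> a b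
        + (if a = b then nv (snd a) * (c a)\<^sup>2 else 0))"
      unfolding quad_def by (intro sum.cong refl)
    then show ?thesis using A(1) by (simp add: quad_def sum.distrib sum_subtractf)
  qed
  ultimately show ?thesis by simp
qed

text \<open>The form of \<open>lam\<close> is the sum over the types of the form of
  \<open>residual\<close> at \<open>c\<close> restricted to that type.\<close>

lemma quad_lam_ge:
  assumes A: "finite A" "A \<subseteq> T"
  shows "quad lam A c \<ge> (\<Sum>a\<in>A. nv (snd a) * (c a)\<^sup>2)"
proof -
  let ?c = "\<lambda>i a. if snd a = i then c a else 0"
  have "(\<Sum>a\<in>A. nv (snd a) * (c a)\<^sup>2) = (\<Sum>a\<in>A. \<Sum>i\<in>snd ` A. if i = snd a then nv (snd a) * (c a)\<^sup>2 else 0)"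
    using A(1) by (intro sum.cong) auto
  also have "\<dots> = (\<Sum>i\<in>snd ` A. \<Sum>a\<in>A. if i = snd a then nv (snd a) * (c a)\<^sup>2 else 0)" by (rule sum.swap)
  also have "\<dots> = (\<Sum>i\<in>snd ` A. \<Sum>a\<in>A. nv (snd a) * (?c i a)\<^sup>2)"
    by (intro sum.cong) auto
  also have "\<dots> \<le> (\<Sum>i\<in>snd ` A. quad residual A (?c i))"
    by (intro sum_mono quad_residual_ge A)
  also have "\<dots> = (\<Sum>a\<in>A. \<Sum>i\<in>snd ` A. \<Sum>b\<in>A. ?c i a * ?c i b * residual a b)"
    unfolding quad_def by (rule sum.swap)
  also have "\<dots> = (\<Sum>a\<in>A. \<Sum>b\<in>A. \<Sum>i\<in>snd ` A. ?c i a * ?c i b * residual a b)"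
    by (intro sum.cong refl sum.swap)
  also have "\<dots> = (\<Sum>a\<in>A. \<Sum>b\<in>A. \<Sum>i\<in>snd ` A. if i = snd a then c a * c b * lam a b else 0)"
    by (intro sum.cong refl) (auto simp: lam_def)
  also have "\<dots> = quad lam A c"
    unfolding quad_def using A(1) by (intro sum.cong) auto
  finally show ?thesis .
qed

lemma quad_K_ge:
  assumes "finite A" "A \<subseteq> T"
  shows "quad K A c \<ge> (\<Sum>a\<in>A. nv (snd a) * (c a)\<^sup>2)"
proof -
  have "quad K A c = quad \<gamma> A c + quad lam A c"
    by (simp add: quad_def K_def sum.distrib algebra_simps)
  then show ?thesis using quad_\<gamma>_nonneg[OF assms, of c] quad_lam_ge[OF assms, of c] by simp
qed

lemma nv_snd_pos: "a \<in> T \<Longrightarrow> nv (snd a) > 0"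
  using nv by (auto simp: tuples_def)

lemma pd_on_K: "finite A \<Longrightarrow> A \<subseteq> T \<Longrightarrow> pd_on K A"
  by (rule pd_on_of_noise[where n = "\<lambda>a. nv (snd a)"]) (auto intro: quad_K_ge nv_snd_pos)

lemma pd_on_lam: "finite A \<Longrightarrow> A \<subseteq> T \<Longrightarrow> pd_on lam A"
  by (rule pd_on_of_noise[where n = "\<lambda>a. nv (snd a)"]) (auto intro: quad_lam_ge nv_snd_pos)

lemma det_K_pos:
  assumes "finite A" "A \<subseteq> T"
  shows "det (set_mat K A A) > 0"
  using assms(1) pd_on_K[OF assms]
  by (rule pd_on_det_pos) (intro K_sym subsetD[OF assms(2)])

lemma det_lam_pos:
  assumes "finite A" "A \<subseteq> T"
  shows "det (set_mat lam A A) > 0"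
  using assms(1) pd_on_lam[OF assms]
  by (rule pd_on_det_pos) (intro lam_sym subsetD[OF assms(2)])

lemma cond_var_K_ge:
  assumes "finite A" "insert y A \<subseteq> T" "y \<notin> A"
  shows "cond_var K A y \<ge> nv (snd y)"
proof (rule cond_var_ge[where n = "\<lambda>a. nv (snd a)", OF assms(1,3)])
  show "pd_on K A" using assms by (intro pd_on_K) auto
  show "K a b = K b a" if "a \<in> insert y A" "b \<in> insert y A" for a b
    by (intro K_sym subsetD[OF assms(2)] that)
  show "quad K (insert y A) z \<ge> (\<Sum>a\<in>insert y A. nv (snd a) * (z a)\<^sup>2)" for z
    using assms by (intro quad_K_ge) auto
  show "nv (snd a) \<ge> 0" if "a \<in> A" for a
    using nv_snd_pos[of a] assms(2) that by (meson insertI2 less_imp_le subsetD)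
qed

lemma cond_var_K_antimono:
  assumes "finite B" "insert y B \<subseteq> T" "y \<notin> B" "A \<subseteq> B"
  shows "cond_var K B y \<le> cond_var K A y"
proof (rule cond_var_antimono[OF assms(1,3,4)])
  show "pd_on K B" using assms by (intro pd_on_K) auto
  show "K a b = K b a" if "a \<in> insert y B" "b \<in> insert y B" for a b
    by (intro K_sym subsetD[OF assms(2)] that)
qed

section \<open>Entropies and the criterion as log-determinants\<close>

text \<open>Sylvester's identity trades the determinant over \<open>U\<close> in the posterior
  covariance of L_U for determinants over \<open>A\<close>; the prior entropy then cancels.\<close>

lemma I_L_eq:
  assumes A: "finite A" "A \<subseteq> T"
  shows "I_L P sv nv U A = 1 / 2 * (ln (det (set_mat K A A)) - ln (det (set_mat lam A A)))"
proof -
  let ?S = "Sigma_UU P U" and ?B = "Sigma_AU P sv U A" and ?L = "Lam P sv nv U A"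
  let ?n = "card U" and ?m = "card A"
  define Q where "Q = ?S + transpose_mat ?B * minv ?L * ?B"
  have S: "?S \<in> carrier_mat ?n ?n" by (simp add: Sigma_UU_def)
  have B: "?B \<in> carrier_mat ?m ?n" by (simp add: Sigma_AU_def)
  have C: "transpose_mat ?B \<in> carrier_mat ?n ?m" using B by simp
  have L: "?L \<in> carrier_mat ?m ?m" by (simp add: Lam_eq)
  have dL: "det ?L > 0" and dK: "det (set_mat K A A) > 0"
    using det_lam_pos[OF A] det_K_pos[OF A] by (simp_all add: Lam_eq)
  have "?B * minv ?S * transpose_mat ?B + ?L = set_mat K A A"
    using Gam_plus_Lam[of A] by (simp add: Gam_def)
  then have syl: "det Q * det ?L = det ?S * det (set_mat K A A)"
    using det_sylvester[OF S L B C] det_Sigma_UU_pos dL by (simp add: Q_def)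
  then have dQ: "det Q > 0"
    using det_Sigma_UU_pos dK dL by (metis mult_pos_pos zero_less_mult_pos2)
  have Q: "Q \<in> carrier_mat ?n ?n" using S B C L minv_inverse(1)[OF L] dL by (simp add: Q_def)
  note iQ = minv_inverse(1)[OF Q] det_minv[OF Q]
  have "det (Sigma_UU_given P sv nv U A) = det ?S * (1 / det Q) * det ?S"
    unfolding Sigma_UU_given_def Q_def[symmetric] using S iQ dQ by (simp add: det_mult[of _ ?n])
  also have "\<dots> = det ?S * det ?L / det (set_mat K A A)"
    using syl dQ dK det_Sigma_UU_pos by (simp add: field_simps)
  finally have det: "det (Sigma_UU_given P sv nv U A) = det ?S * det ?L / det (set_mat K A A)" .
  have dims: "dim_row (Sigma_UU_given P sv nv U A) = ?n" "dim_row ?S = ?n"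
    by (simp_all add: Sigma_UU_given_def Sigma_UU_def)
  have "H_L_given P sv nv U A = 1 / 2 * (ln ((2 * pi * exp 1) ^ ?n * det ?S)
      + ln (det ?L) - ln (det (set_mat K A A)))"
    unfolding H_L_given_def gauss_entropy_def dims det
    using det_Sigma_UU_pos dL dK by (simp add: ln_mult ln_div)
  then show ?thesis
    unfolding I_L_def H_L_def gauss_entropy_def dims Lam_eq by (simp add: algebra_simps)
qed

lemma I_L_given_eq: "I_L_given P sv nv U B A = I_L P sv nv U (A \<union> B) - I_L P sv nv U A"
  by (simp add: I_L_given_def I_L_def)

lemma of_type_eq:
  assumes "A \<subseteq> T"
  shows "of_type D i A = {a \<in> A. snd a = i}"
  using assms by (auto simp: of_type_def tuples_def)

lemma H_Y_given_L_eq: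
  assumes A: "finite A" "A \<subseteq> T" "\<And>a. a \<in> A \<Longrightarrow> snd a = t"
  shows "H_Y_given_L P sv nv U A
    = 1 / 2 * (real (card A) * ln (2 * pi * exp 1) + ln (det (set_mat lam A A)))"
proof -
  have "set_mat residual A A = set_mat lam A A"
    using A by (intro set_mat_cong) (auto simp: lam_def)
  then show ?thesis
    unfolding H_Y_given_L_def gauss_entropy_def Sigma_given_U_eq
    using det_lam_pos[OF A(1,2)] by (simp add: ln_mult ln_realpow)
qed

text \<open>The \<open>\<Lambda>\<close>-terms cancel, since \<open>\<Lambda>\<close> is block diagonal with respect to the types.\<close>
lemma criterion_eq:
  fixes V X t
  defines "Vt \<equiv> of_type D t V" and "Xt \<equiv> of_type D t X"
  assumes V: "finite V" "V \<subseteq> T" and X: "X \<subseteq> V"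
  shows "criterion P sv nv U D V t X = 1 / 2 * (real (card Xt) * ln (2 * pi * exp 1)
    + ln (det (set_mat K X X)) - ln (det (set_mat K (X \<union> Vt) (X \<union> Vt))) + ln (det (set_mat K Vt Vt)))"
proof -
  have XT: "X \<subseteq> T" "finite X" using V X finite_subset by auto
  have t: "Vt = {a \<in> V. snd a = t}" "Xt = {a \<in> X. snd a = t}"
    unfolding Vt_def Xt_def using of_type_eq V XT by auto
  have fin: "finite Xt" "finite Vt" "Xt \<subseteq> T" "Vt \<subseteq> T" using t V XT by auto
  have un: "X \<union> (Vt - Xt) = X \<union> Vt" using t by auto
  \<comment> \<open>Used for \<open>Xt\<close> and for \<open>Vt\<close>: the factor of
    \<open>X - Xt\<close> is common to \<open>X\<close> and \<open>X \<union> Vt\<close>, so it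
    drops out of the difference of the two information terms.\<close>
  have split: "det (set_mat lam (A \<union> (X - Xt)) (A \<union> (X - Xt)))
     = det (set_mat lam A A) * det (set_mat lam (X - Xt) (X - Xt))"
    if "A \<subseteq> T" "finite A" "\<And>a. a \<in> A \<Longrightarrow> snd a = t" for A
    using that XT t by (intro det_Un_orthogonal pd_on_lam) (auto simp: lam_def)
  have un': "Xt \<union> (X - Xt) = X" "Vt \<union> (X - Xt) = X \<union> Vt" using t X by auto
  have of_t: "\<And>a. a \<in> Xt \<Longrightarrow> snd a = t" "\<And>a. a \<in> Vt \<Longrightarrow> snd a = t" using t by auto
  note lams = split[OF fin(3,1) of_t(1), unfolded un'] split[OF fin(4,2) of_t(2), unfolded un']
  have pos: "det (set_mat lam (X - Xt) (X - Xt)) > 0" "det (set_mat lam Xt Xt) > 0"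
    "det (set_mat lam Vt Vt) > 0"
    using XT fin by (auto intro!: det_lam_pos)
  have "H_Y_given_L P sv nv U Xt
    = 1 / 2 * (real (card Xt) * ln (2 * pi * exp 1) + ln (det (set_mat lam Xt Xt)))"
    by (rule H_Y_given_L_eq[OF fin(1,3) of_t(1)])
  moreover have "I_L P sv nv U X = 1 / 2 * (ln (det (set_mat K X X)) - ln (det (set_mat lam X X)))"
    using XT by (intro I_L_eq)
  moreover have "I_L P sv nv U Vt = 1 / 2 * (ln (det (set_mat K Vt Vt)) - ln (det (set_mat lam Vt Vt)))"
    using fin by (intro I_L_eq)
  moreover have "I_L P sv nv U (X \<union> Vt)
    = 1 / 2 * (ln (det (set_mat K (X \<union> Vt) (X \<union> Vt))) - ln (det (set_mat lam (X \<union> Vt) (X \<union> Vt))))"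
    using XT fin by (intro I_L_eq) auto
  ultimately show ?thesis
    unfolding criterion_def Vt_def[symmetric] Xt_def[symmetric] I_L_given_eq un
    using pos by (simp add: lams ln_mult algebra_simps)
qed

text \<open>\<open>Sigma_PITC\<close> has no \<open>\<Lambda>\<close>-term between the observed and the unobserved tuples, so it is the
  conditional variance of \<open>K\<close> only if no tuple of the type of \<open>y\<close> is observed.\<close>
lemma var_PITC_eq_cond_var:
  assumes A: "finite A" "A \<subseteq> T" and y: "\<And>a. a \<in> A \<Longrightarrow> snd a \<noteq> snd y"
  shows "var_PITC P sv nv U y A = cond_var K A y"
proof -
  have yA: "y \<notin> A" using y by blast
  have enum: "enum_set {y} ! 0 = y"
    using enum_set_nth_mem[of "{y}" 0] by simp
  obtain W where W: "minv (set_mat K A A) = set_mat W A A"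
    "\<And>a c. a \<in> A \<Longrightarrow> c \<in> A \<Longrightarrow> (\<Sum>b\<in>A. K a b * W b c) = of_bool (a = c)"
    using minv_set_mat[OF A(1) pd_on_det_nonzero[OF A(1) pd_on_K[OF A]]] by metis
  \<comment> \<open>The inverse kernel applied to the column of \<open>y\<close> solves the normal
    equations for \<open>K\<close>.\<close>
  define c where "c b = (\<Sum>e\<in>A. W b e * K e y)" for b
  have "(\<Sum>b\<in>A. K a b * c b) = K a y" if a: "a \<in> A" for a
  proof -
    have "(\<Sum>b\<in>A. K a b * c b) = (\<Sum>e\<in>A. (\<Sum>b\<in>A. K a b * W b e) * K e y)"
      unfolding c_def sum_distrib_left sum_distrib_right by (subst sum.swap) (simp add: mult_ac)
    also have "\<dots> = (\<Sum>e\<in>A. if a = e then K e y else 0)"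
      using W(2)[OF a] by (intro sum.cong) auto
    finally show ?thesis using a A(1) by simp
  qed
  then have cv: "cond_var K A y = K y y - (\<Sum>b\<in>A. K y b * c b)"
    using det_insert_normal_eq[OF A(1) yA, of K c] det_K_pos[OF A] by (simp add: cond_var_def)
  have K: "K y a = \<gamma> y a" "K a y = \<gamma> a y" if "a \<in> A" for a
    using y[OF that] by (auto simp: K_def lam_def)
  have "Sigma_PITC P sv nv U {y} A = set_mat (\<lambda>a b. K a b - (\<Sum>e\<in>A. (\<Sum>b\<in>A. \<gamma> a b * W b e) * \<gamma> e b)) {y} {y}"
    unfolding Sigma_PITC_def Gam_plus_Lam unfolding W(1) Gam_eq
    by (simp add: set_mat_mult A(1) set_mat_minus)
  then have "var_PITC P sv nv U y A = K y y - (\<Sum>e\<in>A. (\<Sum>b\<in>A. \<gamma> y b * W b e) * \<gamma> e y)"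
    by (simp add: var_PITC_def set_mat_index enum)
  also have "(\<Sum>e\<in>A. (\<Sum>b\<in>A. \<gamma> y b * W b e) * \<gamma> e y) = (\<Sum>b\<in>A. \<Sum>e\<in>A. \<gamma> y b * W b e * \<gamma> e y)"
    unfolding sum_distrib_right by (rule sum.swap)
  also have "\<dots> = (\<Sum>b\<in>A. K y b * c b)"
    by (simp add: K c_def sum_distrib_left mult_ac)
  finally show ?thesis using cv by simp
qed

end

section \<open>The greedy algorithm\<close>

lemma greedy_subset:
  assumes "greedy F V n X"
  shows "X \<subseteq> V"
  using assms by (induction rule: greedy.induct) (auto simp: is_arg_max_def)

lemma mono_of_insert_mono:
  fixes F :: "'a set \<Rightarrow> real"
  assumes mono: "\<And>X y. X \<subseteq> V \<Longrightarrow> y \<in> V - X \<Longrightarrow> F X \<le> F (insert y X)"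
    and "finite A" "X \<union> A \<subseteq> V"
  shows "F X \<le> F (X \<union> A)"
  using assms(2,3)
proof (induction A rule: finite_induct)
  case (insert y A)
  then have "F (X \<union> A) \<le> F (insert y (X \<union> A))"
    by (cases "y \<in> X \<union> A") (auto simp: insert_absorb intro!: mono)
  with insert show ?case by simp
qed simp

text \<open>Telescoping over \<open>A\<close>, with every gain bounded by the gain at
  \<open>X\<close> itself.\<close>

lemma union_gain_le_sum_gains:
  fixes F :: "'a set \<Rightarrow> real"
  assumes submod: "\<And>A B y. A \<subseteq> B \<Longrightarrow> B \<subseteq> V \<Longrightarrow> y \<in> T - B \<Longrightarrow>
      F (insert y B) - F B \<le> F (insert y A) - F A"
    and "finite A" "A \<subseteq> T - X" "X \<union> A \<subseteq> V"
  shows "F (X \<union> A) - F X \<le> (\<Sum>y\<in>A. F (insert y X) - F X)"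
  using assms(2-)
proof (induction A rule: finite_induct)
  case (insert y A)
  then have "F (insert y (X \<union> A)) - F (X \<union> A) \<le> F (insert y X) - F X"
    by (intro submod) auto
  with insert show ?case by simp
qed simp

text \<open>Submodularity is only needed for the elements of the set \<open>T\<close> the greedy result is compared with.\<close>
lemma greedy_bound:
  fixes F :: "'a set \<Rightarrow> real"
  assumes V: "finite V"
    and mono: "\<And>X y. X \<subseteq> V \<Longrightarrow> y \<in> V - X \<Longrightarrow> F X \<le> F (insert y X)"
    and T: "T \<subseteq> V" "card T \<le> N" "1 \<le> N"
    and submod: "\<And>A B y. A \<subseteq> B \<Longrightarrow> B \<subseteq> V \<Longrightarrow> y \<in> T - B \<Longrightarrow>
      F (insert y B) - F B \<le> F (insert y A) - F A"
    and F0: "F {} = 0" and "greedy F V n X"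
  shows "F X \<ge> (1 - (1 - 1 / real N) ^ n) * F T"
  using assms(8)
proof (induction rule: greedy.induct)
  case greedy_0
  then show ?case using F0 by simp
next
  case (greedy_Suc n X y)
  have XV: "X \<subseteq> V" by (rule greedy_subset[OF greedy_Suc.hyps(1)])
  have y: "y \<in> V - X" and best: "\<And>x. x \<in> V - X \<Longrightarrow> F (X \<union> {x}) - F X \<le> F (X \<union> {y}) - F X"
    using greedy_Suc.hyps(2) by (auto simp: is_arg_max_def not_less)
  define g where "g = F (X \<union> {y}) - F X"
  have g: "g \<ge> 0" using mono[OF XV y] by (simp add: g_def)
  have finT: "finite T" using T V finite_subset by auto
  have "F T \<le> F (T \<union> X)"
    using mono_of_insert_mono[OF mono, of V X T] T XV V finite_subset by auto
  also have "\<dots> = F (X \<union> (T - X))" by (simp add: Un_commute)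
  also have "\<dots> \<le> F X + (\<Sum>x\<in>T - X. F (insert x X) - F X)"
    using union_gain_le_sum_gains[OF submod, of V T "T - X" X] finT XV T(1) by auto
  also have "(\<Sum>x\<in>T - X. F (insert x X) - F X) \<le> (\<Sum>x\<in>T - X. g)"
    using best T(1) by (intro sum_mono) (auto simp: g_def)
  also have "(\<Sum>x\<in>T - X. g) \<le> real N * g"
    using g T(2) card_mono[of T "T - X"] finT by (auto intro!: mult_right_mono)
  finally have step: "F T \<le> F X + real N * g" by simp
  define q where "q = 1 / real N"
  have q: "q \<ge> 0" "q \<le> 1" "q * real N = 1" using T(3) by (auto simp: q_def)
  \<comment> \<open>One greedy step closes at least the fraction \<open>q\<close> of the gap
    \<open>F T - F X\<close>, so the gap shrinks by the factor \<open>1 - q\<close>.\<close>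
  have "q * F T \<le> q * F X + g"
    using mult_left_mono[OF step q(1)] q(3) by (simp add: algebra_simps flip: mult.assoc)
  moreover have "(1 - q) * F X \<ge> (1 - q) * ((1 - (1 - q) ^ n) * F T)"
    using greedy_Suc.IH q by (intro mult_left_mono) (auto simp: q_def)
  ultimately have "F (X \<union> {y}) \<ge> (1 - (1 - q) ^ Suc n) * F T"
    by (simp add: g_def algebra_simps)
  then show ?case by (simp only: q_def)
qed

text \<open>After \<open>N\<close> steps the remaining factor \<open>(1 - 1 / N) ^ N\<close> is at
  most \<open>1 / exp 1\<close>; monotonicity gives \<open>F T \<ge> 0\<close>, which allows
  replacing it.\<close>

lemma greedy_constant_factor:
  fixes F :: "'a set \<Rightarrow> real"
  assumes "finite V"
    and mono: "\<And>X y. X \<subseteq> V \<Longrightarrow> y \<in> V - X \<Longrightarrow> F X \<le> F (insert y X)"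
    and T: "T \<subseteq> V" "card T \<le> N" "1 \<le> N"
    and submod: "\<And>A B y. A \<subseteq> B \<Longrightarrow> B \<subseteq> V \<Longrightarrow> y \<in> T - B \<Longrightarrow>
      F (insert y B) - F B \<le> F (insert y A) - F A"
    and F0: "F {} = 0" and X: "greedy F V N X"
  shows "F X \<ge> (1 - 1 / exp 1) * F T"
proof -
  have "1 - 1 / real N \<le> exp (- 1 / real N)"
    using exp_ge_add_one_self[of "- 1 / real N"] by simp
  then have "(1 - 1 / real N) ^ N \<le> exp (- 1 / real N) ^ N"
    using T(3) by (intro power_mono) auto
  also have "\<dots> = 1 / exp 1"
    using T(3) by (simp add: exp_of_nat_mult[symmetric] exp_minus field_simps)
  finally have "1 - 1 / exp 1 \<le> 1 - (1 - 1 / real N) ^ N" by simp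
  moreover have "F T \<ge> 0"
    using mono_of_insert_mono[OF mono, of V T "{}"] T(1) F0 assms(1) finite_subset by auto
  ultimately have "(1 - 1 / exp 1) * F T \<le> (1 - (1 - 1 / real N) ^ N) * F T"
    by (rule mult_right_mono)
  also have "\<dots> \<le> F X" using greedy_bound[OF assms] .
  finally show ?thesis .
qed

lemma ln_triple_product_le:
  fixes a b c x y z :: real
  assumes le: "a * b * c \<le> x * y * z" and pos: "a > 0" "b > 0" "x > 0" "y > 0" "c > 0" "z > 0"
  shows "ln a + ln b + ln c \<le> ln x + ln y + ln z"
proof -
  have "ln (a * b * c) \<le> ln (x * y * z)" using le pos by simp
  then show ?thesis using pos by (simp add: ln_mult)
qed

theorem theorem2:
  fixes d M N t :: nat
    and D U :: "real vec set"
    and V X Xstar :: "tuple set"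
    and P :: "nat \<Rightarrow> real mat"
    and sv nv :: "nat \<Rightarrow> real"
    and nstar \<epsilon>1 \<epsilon> :: real
    and F :: "tuple set \<Rightarrow> real"
  assumes D: "D \<subseteq> carrier_vec d"
    and U: "finite U" "U \<subseteq> D"
    and V: "finite V" "V \<subseteq> tuples M D"
    and t: "t \<in> {1..M}"
    and P: "\<And>i. i \<in> {0..M} \<Longrightarrow>
          P i \<in> carrier_mat d d \<and> diagonal_mat (P i) \<and> (\<forall>k<d. P i $$ (k, k) > 0)"
    and sv: "\<And>i. i \<in> {1..M} \<Longrightarrow> sv i \<ge> 0"
    and nv: "\<And>i. i \<in> {1..M} \<Longrightarrow> nv i > 0"
    and nstar: "nstar = Min (nv ` {1..M})" "nstar \<ge> 1 / (2 * pi * exp 1)"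
    and F: "F = criterion P sv nv U D V t"
    and N: "1 \<le> N" "N \<le> card V"
    and Xstar: "is_arg_max F (\<lambda>A. A \<subseteq> V \<and> card A = N) Xstar"
    and eps1: "\<epsilon>1 \<ge> 0"
    and var_reduction: "\<And>A A' y. A' \<subseteq> A \<Longrightarrow> A \<subseteq> V \<Longrightarrow>
          y \<in> not_of_type M D t V - not_of_type M D t A \<Longrightarrow>
          var_PITC P sv nv U y (A' \<union> (of_type D t V - of_type D t A))
          - var_PITC P sv nv U y (A \<union> (of_type D t V - of_type D t A)) \<le> \<epsilon>1"
    and X: "greedy F V N X"
    and eps: "\<epsilon> = 1 / 2 * ln (1 + \<epsilon>1 / nstar)"
  shows "F X \<ge> (1 - 1 / exp 1) * (F Xstar - real N * \<epsilon>)"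
proof -
  interpret pitc d M D U P sv nv
    using D U P sv nv by unfold_locales
  have le_nv: "nstar \<le> nv i" if "i \<in> {1..M}" for i
    using that nstar(1) by simp
  have "nstar \<in> nv ` {1..M}" using t nstar(1) by simp
  then have nstar_pos: "nstar > 0" using nv by auto
  have nv_snd: "nstar \<le> nv (snd a)" if "a \<in> V" for a
    using that V(2) le_nv by (auto simp: tuples_def)
  define c where "c = 2 * pi * exp (1 :: real)"
  have c: "c > 0" by (simp add: c_def)
  \<comment> \<open>The lower bound on the noise enters here: it makes the gain at each tuple of
    type \<open>t\<close> nonnegative.\<close>
  have c_nstar: "c * nstar \<ge> 1" using nstar(2) c by (simp add: c_def field_simps)
  define E where "E A = ln (det (set_mat K A A))" for A
  define Vt where "Vt = of_type D t V"
  have Vt: "Vt = {a \<in> V. snd a = t}" unfolding Vt_def by (rule of_type_eq[OF V(2)])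
  have sub: "finite A" "A \<subseteq> tuples M D" if "A \<subseteq> V" for A
    using that V finite_subset by auto
  have F_eq: "F A = 1 / 2 * (real (card (A \<inter> Vt)) * ln c + E A - E (A \<union> Vt) + E Vt)" if "A \<subseteq> V" for A
  proof -
    have "of_type D t A = A \<inter> Vt" using of_type_eq[OF sub(2)[OF that]] that Vt by auto
    then show ?thesis using criterion_eq[OF V that, of t] by (simp add: F E_def Vt_def c_def)
  qed
  have E_insert: "E (insert y A) = E A + ln (cond_var K A y)" and cv: "cond_var K A y \<ge> nstar"
    if "insert y A \<subseteq> V" "y \<notin> A" for A y
  proof -
    note s = sub[OF that(1)]
    then have A: "finite A" "A \<subseteq> tuples M D" by auto
    show "cond_var K A y \<ge> nstar"
      using cond_var_K_ge[OF A(1) s(2) that(2)] nv_snd[of y] that(1) by simp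
    then show "E (insert y A) = E A + ln (cond_var K A y)"
      unfolding E_def using nstar_pos det_K_pos[OF A]
      by (simp add: det_insert_cond_var[OF A(1) pd_on_K[OF A]] ln_mult)
  qed
  have cv_anti: "cond_var K B y \<le> cond_var K A y" if "insert y B \<subseteq> V" "y \<notin> B" "A \<subseteq> B" for A B y
    using sub[OF that(1)] that by (intro cond_var_K_antimono) auto
  \<comment> \<open>As \<open>y\<close> already lies in \<open>Vt\<close>, the set
    \<open>A \<union> Vt\<close> is unchanged and only the count and \<open>E A\<close>
    grow.\<close>
  have gain_t: "F (insert y A) - F A = 1 / 2 * ln (c * cond_var K A y)" if "A \<subseteq> V" "y \<in> Vt - A" for A y
  proof -
    have y: "insert y A \<subseteq> V" "y \<notin> A" using that Vt by auto
    have "insert y A \<union> Vt = A \<union> Vt" "insert y A \<inter> Vt = insert y (A \<inter> Vt)" using that by auto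
    moreover have "card (insert y (A \<inter> Vt)) = Suc (card (A \<inter> Vt))"
      using sub(1)[OF that(1)] y by simp
    ultimately show ?thesis
      using cv[OF y] nstar_pos c
      by (simp add: F_eq[OF y(1)] F_eq[OF that(1)] E_insert[OF y] ln_mult algebra_simps)
  qed
  have mono: "F A \<le> F (insert y A)" if "A \<subseteq> V" "y \<in> V - A" for A y
  proof (cases "y \<in> Vt")
    case True
    have "1 \<le> c * cond_var K A y"
      using c_nstar cv[of y A] that c by (smt (verit) Diff_iff insert_subset mult_left_mono)
    then have "ln (c * cond_var K A y) \<ge> 0" by simp
    then show ?thesis using gain_t[OF that(1), of y] True that by simp
  next
    \<comment> \<open>For another type the gain is half the difference of the log conditional
      variances given \<open>A\<close> and given \<open>A \<union> Vt\<close>, nonnegative since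
      conditioning reduces variance.\<close>
    case False
    have y: "insert y A \<subseteq> V" "y \<notin> A" and y': "insert y (A \<union> Vt) \<subseteq> V" "y \<notin> A \<union> Vt"
      using that False Vt by auto
    have "cond_var K (A \<union> Vt) y \<le> cond_var K A y" using y' by (intro cv_anti) auto
    then have "ln (cond_var K (A \<union> Vt) y) \<le> ln (cond_var K A y)"
      using cv[OF y'] nstar_pos by simp
    moreover have "insert y A \<union> Vt = insert y (A \<union> Vt)" "insert y A \<inter> Vt = A \<inter> Vt"
      using False by auto
    ultimately show ?thesis
      by (simp add: F_eq[OF y(1)] F_eq[OF that(1)] E_insert[OF y] E_insert[OF y'])
  qed
  have submod: "F (insert y B) - F B \<le> F (insert y A) - F A"
    if "A \<subseteq> B" "B \<subseteq> V" "y \<in> Vt - B" for A B y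
  proof -
    have y: "insert y B \<subseteq> V" "y \<notin> B" using that Vt by auto
    have "c * cond_var K B y \<le> c * cond_var K A y" "c * cond_var K B y > 0"
      using cv_anti[OF y that(1)] cv[OF y] nstar_pos c by auto
    then have "ln (c * cond_var K B y) \<le> ln (c * cond_var K A y)" by simp
    moreover have "A \<subseteq> V" "y \<in> Vt - A" using that by auto
    ultimately show ?thesis using gain_t[of A y] gain_t[OF that(2,3)] by simp
  qed
  have F0: "F {} = 0" using F_eq[of "{}"] by (simp add: E_def set_mat_def)
  have Xs: "Xstar \<subseteq> V" "card Xstar = N" using Xstar by (auto simp: is_arg_max_def)
  have finXs: "finite Xstar" by (rule sub(1)[OF Xs(1)])
  define S where "S = Xstar \<inter> Vt"
  define Y where "Y = Xstar - Vt"
  have S: "S \<subseteq> V" "S \<subseteq> Vt" "card S \<le> N" and Y: "card Y \<le> N" "finite Y" "Y \<inter> Vt = {}" "Y \<union> S = Xstar"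
    using Xs finXs by (auto simp: S_def Y_def intro: card_mono)
  have YV: "Y \<union> Vt \<subseteq> V" using Xs(1) Vt by (auto simp: Y_def)
  note YVt = sub[OF YV]
  \<comment> \<open>The hypothesis is taken for the pair \<open>S \<subseteq> Vt\<close>, for which
    \<open>Vt\<close> minus the observed tuples of type \<open>t\<close> is empty. As
    \<open>y\<close> has another type, the two given variances are conditional variances under
    \<open>K\<close>.\<close>
  have reduction: "cond_var K S y - cond_var K Vt y \<le> \<epsilon>1" if y: "y \<in> Y" for y
  proof -
    have yV: "y \<in> V" "snd y \<noteq> t" using y Xs(1) Vt by (auto simp: Y_def)
    then have "y \<in> not_of_type M D t V - not_of_type M D t Vt"
      using V(2) Vt by (auto simp: not_of_type_def of_type_def tuples_def)
    moreover have "of_type D t Vt = Vt" using of_type_eq[OF sub(2), of Vt t] Vt by auto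
    ultimately have "var_PITC P sv nv U y S - var_PITC P sv nv U y Vt \<le> \<epsilon>1"
      using var_reduction[of S Vt y] S(2) YV unfolding Vt_def[symmetric] by simp
    moreover have "var_PITC P sv nv U y A = cond_var K A y" if "A \<subseteq> Vt" for A
      using that yV YV Vt sub[of A] by (intro var_PITC_eq_cond_var) auto
    ultimately show ?thesis using S(2) by simp
  qed
  have "det (set_mat K (Y \<union> S) (Y \<union> S)) * det (set_mat K Vt Vt) * nstar ^ card Y
    \<le> det (set_mat K S S) * det (set_mat K (Y \<union> Vt) (Y \<union> Vt)) * (nstar + \<epsilon>1) ^ card Y"
  \<comment> \<open>Here \<open>Vt\<close> is the full conditioning set, \<open>S\<close> the
    smaller one, \<open>nstar\<close> the noise level and \<open>\<epsilon>1\<close> the variance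
    gap.\<close>
  proof (rule det_information_bound)
    show "quad K (Y \<union> Vt) c \<ge> nstar * (\<Sum>y\<in>Y. (c y)\<^sup>2)" for c
    proof -
      have "nstar * (\<Sum>y\<in>Y. (c y)\<^sup>2) \<le> (\<Sum>a\<in>Y. nv (snd a) * (c a)\<^sup>2)"
        unfolding sum_distrib_left using nv_snd YV by (intro sum_mono mult_right_mono) auto
      also have "\<dots> \<le> (\<Sum>a\<in>Y \<union> Vt. nv (snd a) * (c a)\<^sup>2)"
      proof (intro sum_mono2)
        show "0 \<le> nv (snd b) * (c b)\<^sup>2" if "b \<in> Y \<union> Vt - Y" for b
          using nv_snd_pos[of b] YVt(2) that by (intro mult_nonneg_nonneg) auto
      qed (use YVt in auto)
      also have "\<dots> \<le> quad K (Y \<union> Vt) c" by (rule quad_K_ge[OF YVt])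
      finally show ?thesis .
    qed
    show "pd_on K (Y \<union> Vt)" by (rule pd_on_K[OF YVt])
    show "K a b = K b a" if "a \<in> Y \<union> Vt" "b \<in> Y \<union> Vt" for a b
      using that YVt(2) by (intro K_sym) auto
  qed (use S Y YVt nstar_pos eps1 reduction in auto)
  moreover have "det (set_mat K (Y \<union> S) (Y \<union> S)) > 0" "det (set_mat K Vt Vt) > 0"
    "det (set_mat K S S) > 0" "det (set_mat K (Y \<union> Vt) (Y \<union> Vt)) > 0"
    using sub[of "Y \<union> S"] sub[of Vt] sub[of S] YVt S YV by (auto intro!: det_K_pos)
  moreover have "nstar ^ card Y > 0" "(nstar + \<epsilon>1) ^ card Y > 0" using nstar_pos eps1 by auto
  ultimately have "E (Y \<union> S) + E Vt + ln (nstar ^ card Y)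
    \<le> E S + E (Y \<union> Vt) + ln ((nstar + \<epsilon>1) ^ card Y)"
    unfolding E_def by (rule ln_triple_product_le)
  \<comment> \<open>Each element of \<open>Y\<close> costs
    \<open>ln (nstar + \<epsilon>1) - ln nstar\<close>, which is \<open>2 * \<epsilon>\<close>; the
    factor 2 cancels against the half in \<open>F\<close>.\<close>
  then have info: "E (Y \<union> S) - E (Y \<union> Vt) + E Vt \<le> E S + real (card Y) * (2 * \<epsilon>)"
  proof -
    have "1 + \<epsilon>1 / nstar = (nstar + \<epsilon>1) / nstar" using nstar_pos by (simp add: field_simps)
    then have "ln (nstar + \<epsilon>1) = 2 * \<epsilon> + ln nstar" using eps nstar_pos eps1 by (simp add: ln_div)
    then have "real (card Y) * ln (nstar + \<epsilon>1) = real (card Y) * (2 * \<epsilon>) + real (card Y) * ln nstar"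
      by (simp only: distrib_left)
    then show ?thesis
      using \<open>E (Y \<union> S) + E Vt + ln (nstar ^ card Y) \<le> _\<close> nstar_pos eps1
      by (simp add: ln_realpow)
  qed
  have "ln (1 + \<epsilon>1 / nstar) \<ge> 0" using eps1 nstar_pos by (intro ln_ge_zero) simp
  then have "\<epsilon> \<ge> 0" using eps by simp
  then have "real (card Y) * \<epsilon> \<le> real N * \<epsilon>" using Y(1) by (simp add: mult_right_mono)
  moreover have "Xstar \<union> Vt = Y \<union> Vt" "S \<union> Vt = Vt" "S \<inter> Vt = Xstar \<inter> Vt"
    by (auto simp: S_def Y_def)
  \<comment> \<open>For \<open>S \<subseteq> Vt\<close> the terms \<open>E (S \<union> Vt)\<close>
    and \<open>E Vt\<close> cancel in \<open>F S\<close>, and \<open>S\<close> and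
    \<open>Xstar\<close> have the same number of tuples of type \<open>t\<close>.\<close>
  ultimately have "F Xstar \<le> F S + real N * \<epsilon>"
    using info by (simp add: F_eq[OF Xs(1)] F_eq[OF S(1)] Y(4) algebra_simps)
  then have "(1 - 1 / exp 1) * (F Xstar - real N * \<epsilon>) \<le> (1 - 1 / exp 1) * F S"
    by (intro mult_left_mono) auto
  also have "\<dots> \<le> F X"
    using S submod by (intro greedy_constant_factor[OF V(1) mono S(1,3) N(1) _ F0 X]) auto
  finally show ?thesis .
qed

end
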